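(* Let $h\in\mathbb{C}\setminus\mathbb{Q}$, $q=e^{\pi \mathrm{i}h}$, let $u_1,\dots,u_{m+n}$ be pairwise distinct complex numbers, and let $d$ be an admissible direction such that for all $i<j$ one has $e^{h(u_i-u_j)z}\to0$ as $z\to\infty$ along $d+\frac\pi2$. Consider the system $$\frac{dF}{dz}=h\Bigl(U+\frac Pz\Bigr)F,\qquad U=\sum_{i=1}^{m+n}1\otimes u_iE_{ii},\qquad P=-\sum_{k,l=1}^{m+n}(-1)^{\bar l}E_{kl}\otimes E_{lk},$$ valued in $\mathrm{End}(\mathbb{C}^{m|n})\otimes\mathrm{End}(\mathbb{C}^{m|n})$, and its renormalized Stokes matrix $S_{h+}(U)=S_d^+(U)\,e^{\pi \mathrm{i}h\,\delta P}$. Then $S_{h+}(U)^{-1}=R$, where $$R=\sum_{i=1}^{m+n}q^{(-1)^{\bar i}}E_{ii}\otimes E_{ii}+\sum_{i\ne j}E_{ii}\otimes E_{jj}+(q-q^{-1})\sum_{i<j}(-1)^{\bar i}E_{ji}\otimes E_{ij}$$ is the standard super $R$-matrix of $U_q(\mathfrak{gl}(m|n))$.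
   Context: For $1\le i\le m+n$ let $\bar i=0$ if $i\le m$ and $\bar i=1$ if $i>m$; $E_{ij}\in\mathrm{End}(\mathbb{C}^{m|n})$ are the matrix units, of parity $\bar i+\bar j$. Tensor products of superalgebras carry the product $(a\otimes b)(a'\otimes b')=(-1)^{|b||a'|}aa'\otimes bb'$. The system is the case of $\frac{dF}{dz}=h(u+\frac Tz)F$, $u=\sum_i1\otimes u_iE_{ii}$, $T=\sum_{k,l}(-1)^{\bar k\bar l}e_{kl}\otimes E_{kl}$, in which the generators $e_{kl}$ of $\mathfrak{gl}_{m|n}$ act on $\mathbb{C}^{m|n}$ through the dual natural representation $e_{ij}\mapsto-(-1)^{\bar i(\bar j+1)}E_{ji}$. Let $\delta P=-\sum_k(-1)^{\bar k}E_{kk}\otimes E_{kk}$ (the diagonal part of $P$). For $h\notin\mathbb{Q}$ there is a unique formal solution $\widehat H(z)e^{hUz}z^{h\delta P}$ with $\widehat H=I+O(z^{-1})$ a formal power series in $z^{-1}$. Directions are identified with their arguments in $\mathbb{R}$. Anti-Stokes directions: $-\mathrm{Arg}(h(u_i-u_j))+2k\pi$ ($i\ne j$, $k\in\mathbb{Z}$); all other directions are admissible. For $d$ admissible between consecutive anti-Stokes directions $\tau<d<\tau'$, $F_d(z)$ is the unique holomorphic fundamental solution on the universal cover of $\mathbb{C}^\times$ with $F_d(z)z^{-h\delta P}e^{-hUz}\sim\widehat H(z)$ (Poincaré asymptotic expansion) as $z\to\infty$ with $\arg z\in(\tau-\frac\pi2,\tau'+\frac\pi2)$. The Stokes matrix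 $S_d^+(U)$ is defined by $F_d(z)=F_{d+\pi}(z)S_d^+(U)$. *)

theory Defs
  imports "HOL-Analysis.Analysis" "HOL-Library.Function_Algebras"
begin

text \<open>
  An element of \<open>End(\<complex>\<^sup>m\<^sup>|\<^sup>n) \<otimes> End(\<complex>\<^sup>m\<^sup>|\<^sup>n)\<close> is given by its coefficients: \<open>A i j k l\<close> is the
  coefficient of \<open>E\<^sub>i\<^sub>j \<otimes> E\<^sub>k\<^sub>l\<close>, with all indices in \<open>{1..m+n}\<close> (and \<open>0\<close> outside that range).
  Addition, zero and finite sums are the pointwise ones.
\<close>

type_synonym tens = "nat \<Rightarrow> nat \<Rightarrow> nat \<Rightarrow> nat \<Rightarrow> complex"

definition tens_carrier :: "nat \<Rightarrow> nat \<Rightarrow> tens set" where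
  "tens_carrier m n = {A. \<forall>i j k l. A i j k l \<noteq> 0 \<longrightarrow>
      i \<in> {1..m+n} \<and> j \<in> {1..m+n} \<and> k \<in> {1..m+n} \<and> l \<in> {1..m+n}}"

definition par :: "nat \<Rightarrow> nat \<Rightarrow> nat" where
  "par m i = (if i \<le> m then 0 else 1)"

definition EE :: "nat \<Rightarrow> nat \<Rightarrow> nat \<Rightarrow> nat \<Rightarrow> tens" where
  "EE i j k l = (\<lambda>a b c d. if a = i \<and> b = j \<and> c = k \<and> d = l then 1 else 0)"

definition tscale :: "complex \<Rightarrow> tens \<Rightarrow> tens" where
  "tscale c A = (\<lambda>i j k l. c * A i j k l)"

text \<open>
  The product of the super tensor product, i.e. the bilinear extension of
  \<open>(E\<^sub>i\<^sub>p \<otimes> E\<^sub>k\<^sub>r)(E\<^sub>p\<^sub>j \<otimes> E\<^sub>r\<^sub>l) = (-1)\<^bsup>|E\<^sub>k\<^sub>r||E\<^sub>p\<^sub>j|\<^esup> E\<^sub>i\<^sub>j \<otimes> E\<^sub>k\<^sub>l\<close>; see \<open>EE_tmult\<close> below.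
\<close>

definition tmult :: "nat \<Rightarrow> nat \<Rightarrow> tens \<Rightarrow> tens \<Rightarrow> tens" where
  "tmult m n A B = (\<lambda>i j k l. \<Sum>p = 1..m+n. \<Sum>r = 1..m+n.
      (-1) ^ ((par m k + par m r) * (par m p + par m j)) * A i p k r * B p j r l)"

definition tone :: "nat \<Rightarrow> nat \<Rightarrow> tens" where
  "tone m n = (\<Sum>i = 1..m+n. \<Sum>k = 1..m+n. EE i i k k)"

definition tinverse :: "nat \<Rightarrow> nat \<Rightarrow> tens \<Rightarrow> tens \<Rightarrow> bool" where
  "tinverse m n A B \<longleftrightarrow> A \<in> tens_carrier m n \<and> B \<in> tens_carrier m n \<and>
      tmult m n A B = tone m n \<and> tmult m n B A = tone m n"

primrec tpow :: "nat \<Rightarrow> nat \<Rightarrow> tens \<Rightarrow> nat \<Rightarrow> tens" where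
  "tpow m n A 0 = tone m n"
| "tpow m n A (Suc t) = tmult m n A (tpow m n A t)"

definition texp :: "nat \<Rightarrow> nat \<Rightarrow> tens \<Rightarrow> tens" where
  "texp m n A = (\<lambda>i j k l. \<Sum>t. tpow m n A t i j k l / fact t)"

definition Umat :: "nat \<Rightarrow> nat \<Rightarrow> (nat \<Rightarrow> complex) \<Rightarrow> tens" where
  "Umat m n u = (\<Sum>i = 1..m+n. \<Sum>a = 1..m+n. tscale (u i) (EE a a i i))"

definition Pmat :: "nat \<Rightarrow> nat \<Rightarrow> tens" where
  "Pmat m n = - (\<Sum>k = 1..m+n. \<Sum>l = 1..m+n. tscale ((-1) ^ par m l) (EE k l l k))"

definition deltaP :: "nat \<Rightarrow> nat \<Rightarrow> tens" where
  "deltaP m n = - (\<Sum>k = 1..m+n. tscale ((-1) ^ par m k) (EE k k k k))"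

definition Rmat :: "nat \<Rightarrow> nat \<Rightarrow> complex \<Rightarrow> tens" where
  "Rmat m n q =
     (\<Sum>i = 1..m+n. tscale (q powi ((-1) ^ par m i)) (EE i i i i))
   + (\<Sum>(i, j) \<in> {(i, j). i \<in> {1..m+n} \<and> j \<in> {1..m+n} \<and> i \<noteq> j}. EE i i j j)
   + tscale (q - inverse q)
      (\<Sum>(i, j) \<in> {(i, j). i \<in> {1..m+n} \<and> j \<in> {1..m+n} \<and> i < j}.
         tscale ((-1) ^ par m i) (EE j i i j))"

text \<open>
  \<open>H t\<close> is the coefficient of \<open>z\<^sup>-\<^sup>t\<close> in \<open>\<Sum>\<^sub>t H\<^sub>t z\<^sup>-\<^sup>t\<close>; the two operations below are formal
  multiplication by \<open>z\<^sup>-\<^sup>1\<close> and formal differentiation with respect to \<open>z\<close>.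
\<close>

definition zinv_times :: "(nat \<Rightarrow> tens) \<Rightarrow> nat \<Rightarrow> tens" where
  "zinv_times H t = (case t of 0 \<Rightarrow> 0 | Suc s \<Rightarrow> H s)"

definition formal_ddz :: "(nat \<Rightarrow> tens) \<Rightarrow> nat \<Rightarrow> tens" where
  "formal_ddz H t = (case t of 0 \<Rightarrow> 0 | Suc s \<Rightarrow> tscale (- of_nat s) (H s))"

text \<open>
  \<open>H(z) e\<^bsup>hUz\<^esup> z\<^bsup>h \<delta>P\<^esup>\<close> solves \<open>F' = h (U + P/z) F\<close> formally.  As \<open>U\<close> and \<open>\<delta>P\<close> commute,
  cancelling the invertible factor \<open>e\<^bsup>hUz\<^esup> z\<^bsup>h \<delta>P\<^esup>\<close> on the right turns this into
  \<open>H' + H (hU) + z\<^sup>-\<^sup>1 H (h \<delta>P) = hU H + hP z\<^sup>-\<^sup>1 H\<close>, read off coefficientwise.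
\<close>

definition formal_solution ::
  "nat \<Rightarrow> nat \<Rightarrow> complex \<Rightarrow> (nat \<Rightarrow> complex) \<Rightarrow> (nat \<Rightarrow> tens) \<Rightarrow> bool" where
  "formal_solution m n h u H \<longleftrightarrow>
     (\<forall>t. H t \<in> tens_carrier m n) \<and> H 0 = tone m n \<and>
     (\<forall>t. formal_ddz H t + tmult m n (H t) (tscale h (Umat m n u))
            + tmult m n (zinv_times H t) (tscale h (deltaP m n))
          = tmult m n (tscale h (Umat m n u)) (H t)
            + tmult m n (tscale h (Pmat m n)) (zinv_times H t))"

definition anti_Stokes :: "nat \<Rightarrow> nat \<Rightarrow> complex \<Rightarrow> (nat \<Rightarrow> complex) \<Rightarrow> real set" where
  "anti_Stokes m n h u = {- Arg (h * (u i - u j)) + 2 * of_int k * pi | i j (k :: int).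
      i \<in> {1..m+n} \<and> j \<in> {1..m+n} \<and> i \<noteq> j}"

definition admissible :: "nat \<Rightarrow> nat \<Rightarrow> complex \<Rightarrow> (nat \<Rightarrow> complex) \<Rightarrow> real \<Rightarrow> bool" where
  "admissible m n h u d \<longleftrightarrow> d \<notin> anti_Stokes m n h u"

text \<open>
  The interval \<open>(\<tau> - \<pi>/2, \<tau>' + \<pi>/2)\<close> for the consecutive anti-Stokes directions \<open>\<tau> < d < \<tau>'\<close>
  (lemma \<open>Stokes_sector_eq\<close>).  In this form it also makes sense for \<open>m + n = 1\<close>, when there are no
  anti-Stokes directions and the sector is the whole universal cover.
\<close>

definition Stokes_sector :: "nat \<Rightarrow> nat \<Rightarrow> complex \<Rightarrow> (nat \<Rightarrow> complex) \<Rightarrow> real \<Rightarrow> real set" where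
  "Stokes_sector m n h u d = {\<theta>. \<forall>\<tau> \<in> anti_Stokes m n h u.
      (\<tau> < d \<longrightarrow> \<tau> - pi / 2 < \<theta>) \<and> (d < \<tau> \<longrightarrow> \<theta> < \<tau> + pi / 2)}"

text \<open>
  Functions on the universal cover of \<open>\<complex>\<^sup>\<times>\<close> are functions of the global coordinate \<open>w = log z\<close>, so that
  \<open>z = exp w\<close>, \<open>|z| = exp (Re w)\<close>, \<open>arg z = Im w\<close> and \<open>d/dw = z d/dz\<close>.
  A Poincare expansion on an open sector is, as usual, uniform on each closed subsector.
\<close>

definition poincare_asymp :: "(complex \<Rightarrow> tens) \<Rightarrow> (nat \<Rightarrow> tens) \<Rightarrow> real set \<Rightarrow> bool" where
  "poincare_asymp X H I \<longleftrightarrow>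
     (\<forall>a b. {a..b} \<subseteq> I \<longrightarrow> (\<forall>N i j k l. \<exists>C \<rho>. \<forall>w.
        Im w \<in> {a..b} \<and> cmod (exp w) \<ge> \<rho> \<longrightarrow>
        cmod (X w i j k l - (\<Sum>t<N. H t i j k l / exp w ^ t)) \<le> C / cmod (exp w) ^ N))"

definition fundamental_solution ::
  "nat \<Rightarrow> nat \<Rightarrow> complex \<Rightarrow> (nat \<Rightarrow> complex) \<Rightarrow> (complex \<Rightarrow> tens) \<Rightarrow> bool" where
  "fundamental_solution m n h u F \<longleftrightarrow>
     (\<forall>w. \<exists>G. tinverse m n (F w) G) \<and>
     (\<forall>w i j k l. ((\<lambda>w. F w i j k l) has_field_derivative
        exp w * tmult m n (tscale h (Umat m n u + tscale (1 / exp w) (Pmat m n))) (F w) i j k l)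
        (at w))"

definition canonical_solution ::
  "nat \<Rightarrow> nat \<Rightarrow> complex \<Rightarrow> (nat \<Rightarrow> complex) \<Rightarrow> (nat \<Rightarrow> tens) \<Rightarrow> real \<Rightarrow> (complex \<Rightarrow> tens) \<Rightarrow> bool" where
  "canonical_solution m n h u H d F \<longleftrightarrow>
     fundamental_solution m n h u F \<and>
     poincare_asymp
       (\<lambda>w. tmult m n (tmult m n (F w) (texp m n (tscale (- h * w) (deltaP m n))))
              (texp m n (tscale (- h * exp w) (Umat m n u))))
       H (Stokes_sector m n h u d)"

definition Stokes_plus ::
  "nat \<Rightarrow> nat \<Rightarrow> complex \<Rightarrow> (nat \<Rightarrow> complex) \<Rightarrow> real \<Rightarrow> tens \<Rightarrow> bool" where
  "Stokes_plus m n h u d S \<longleftrightarrow> S \<in> tens_carrier m n \<and>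
     (\<exists>H F F'. formal_solution m n h u H \<and>
        canonical_solution m n h u H d F \<and> canonical_solution m n h u H (d + pi) F' \<and>
        (\<forall>w. F w = tmult m n (F' w) S))"

definition renormalized :: "nat \<Rightarrow> nat \<Rightarrow> complex \<Rightarrow> tens \<Rightarrow> tens" where
  "renormalized m n h S = tmult m n S (texp m n (tscale (pi * \<i> * h) (deltaP m n)))"

lemma EE_tmult:
  assumes "j \<in> {1..m+n}" "l \<in> {1..m+n}"
  shows "tmult m n (EE i j k l) (EE i' j' k' l') =
    (if j = i' \<and> l = k'
     then tscale ((-1) ^ ((par m k + par m l) * (par m i' + par m j'))) (EE i j' k l') else 0)"
proof (intro ext)
  fix a b c d
  have "tmult m n (EE i j k l) (EE i' j' k' l') a b c d =
     (\<Sum>p = 1..m+n. \<Sum>r = 1..m+n. if p = j then (if r = l then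
       (-1) ^ ((par m c + par m l) * (par m j + par m b)) * EE i j k l a j c l * EE i' j' k' l' j b l d
       else 0) else 0)"
    unfolding tmult_def by (intro sum.cong refl) (auto simp: EE_def)
  also have "\<dots> = (\<Sum>p = 1..m+n. if p = j then 
       (-1) ^ ((par m c + par m l) * (par m j + par m b)) * EE i j k l a j c l * EE i' j' k' l' j b l d
       else 0)"
    using assms by (intro sum.cong refl) auto
  also have "\<dots> = (-1) ^ ((par m c + par m l) * (par m j + par m b)) * EE i j k l a j c l * EE i' j' k' l' j b l d"
    using assms by simp
  finally show "tmult m n (EE i j k l) (EE i' j' k' l') a b c d =
    (if j = i' \<and> l = k'
     then tscale ((-1) ^ ((par m k + par m l) * (par m i' + par m j'))) (EE i j' k l') else 0) a b c d"
    by (auto simp: EE_def tscale_def)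
qed

lemma Stokes_sector_eq:
  assumes "\<tau> \<in> anti_Stokes m n h u" "\<tau>' \<in> anti_Stokes m n h u" "\<tau> < d" "d < \<tau>'"
    and "{\<tau><..<\<tau>'} \<inter> anti_Stokes m n h u = {}"
  shows "Stokes_sector m n h u d = {\<tau> - pi / 2<..<\<tau>' + pi / 2}"
proof -
  have "\<sigma> \<le> \<tau> \<or> \<tau>' \<le> \<sigma>" if "\<sigma> \<in> anti_Stokes m n h u" for \<sigma>
    using assms(5) that by force
  then show ?thesis
    using assms(1-4) unfolding Stokes_sector_def by fastforce
qed

end

theory Submission
  imports Defs "HOL-Real_Asymp.Real_Asymp"
begin

text \<open>
  The sign twist \<open>tw\<close> turns the super tensor product into ordinary matrices indexed by pairs, and \<open>P\<close>
  into minus the signed flip.  The system then splits into blocks \<open>{(i,k), (k,i)}\<close>.  Multiplying a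
  canonical solution \<open>F\<close> on the left by a block scalar gives \<open>F C\<close> with \<open>C\<close> constant; comparing
  growth on the two opposite rays \<open>d \<plusminus> \<pi>/2\<close>, and using that \<open>z\<^sup>\<plusminus>\<^sup>h\<close> has no expansion in powers
  of \<open>1/z\<close>, shows that \<open>C\<close> is that block scalar, so \<open>F\<close> and the Stokes matrix are block diagonal
  and only one entry \<open>s\<close> per block remains unknown.

  In a block, \<open>z \<mapsto> -z\<close> combined with the flip (and a scalar exponential) is a symmetry of the system.
  The Frobenius solution at \<open>z = 0\<close> with exponent \<open>-g\<close>, \<open>g = \<plusminus>h\<close>, is an eigenvector with eigenvalue
  \<open>\<kappa> = e\<^bsup>-\<pi>ig\<^esup>\<close>.  The symmetry exchanges the canonical solutions for \<open>d\<close> and \<open>d + \<pi>\<close>, so reading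
  off the leading coefficients of the eigenvector on three rays gives \<open>s = \<kappa> - 1/\<kappa>\<close>.
\<close>

subsection \<open>Linear systems and asymptotics along rays\<close>

text \<open>Gronwall along the segment from 0 to \<open>w\<close>: the energy \<open>g t\<close>,
  the sum of the squared moduli of the components at \<open>t w\<close>, satisfies
  \<open>g' \<le> 2 L g\<close> and starts at 0, so it vanishes at \<open>t = 1\<close>.\<close>

lemma linear_ode_zero:
  fixes f :: "complex \<Rightarrow> 'k \<Rightarrow> complex" and M :: "complex \<Rightarrow> 'k \<Rightarrow> 'k \<Rightarrow> complex"
  assumes fin: "finite K"
    and deriv: "\<And>w x. x \<in> K \<Longrightarrow>
      ((\<lambda>w. f w x) has_field_derivative (\<Sum>y\<in>K. M w x y * f w y)) (at w)"
    and cont: "\<And>x y. x \<in> K \<Longrightarrow> y \<in> K \<Longrightarrow> continuous_on UNIV (\<lambda>w. M w x y)"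
    and init: "\<And>x. x \<in> K \<Longrightarrow> f 0 x = 0"
    and x: "x \<in> K"
  shows "f w x = 0"
proof -
  \<comment> \<open>\<open>B\<close> adds up the moduli of all entries of the coefficient matrix
    pulled back to the segment; compactness of the segment bounds it by \<open>L\<close>.\<close>
  define B where "B = (\<lambda>t::real. \<Sum>x\<in>K. \<Sum>y\<in>K. cmod (w * M (of_real t * w) x y))"
  define g where "g = (\<lambda>t::real. \<Sum>x\<in>K. (cmod (f (of_real t * w) x))\<^sup>2)"
  define g' where "g' = (\<lambda>t::real. \<Sum>x\<in>K. 2 * (f (of_real t * w) x \<bullet>
      (w * (\<Sum>y\<in>K. M (of_real t * w) x y * f (of_real t * w) y))))"
  have "continuous_on {0..1} B"
    unfolding B_def
    by (intro continuous_on_sum continuous_on_norm continuous_on_mult continuous_on_const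
        continuous_on_compose2[OF cont] continuous_on_of_real continuous_on_id) auto
  then have "bounded (B ` {0..1})"
    by (simp add: compact_continuous_image compact_imp_bounded)
  then obtain L where L: "\<And>t. t \<in> {0..1} \<Longrightarrow> B t \<le> L"
    unfolding bounded_iff by (metis abs_le_D1 imageI real_norm_def)
  have vd: "((\<lambda>t. f (of_real t * w) x) has_vector_derivative
      w * (\<Sum>y\<in>K. M (of_real t * w) x y * f (of_real t * w) y)) (at t)"
    if "x \<in> K" for x and t :: real
  proof -
    have "((\<lambda>t::real. of_real t * w) has_vector_derivative w) (at t)"
      by (auto intro!: derivative_eq_intros)
    from field_vector_diff_chain_at[OF this deriv[OF that]]
    show ?thesis by (simp add: o_def)
  qed
  have gd: "(g has_real_derivative g' t) (at t)" for t
  proof -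
    have "((\<lambda>t. (cmod (f (of_real t * w) x))\<^sup>2) has_real_derivative
        2 * (f (of_real t * w) x \<bullet> (w * (\<Sum>y\<in>K. M (of_real t * w) x y * f (of_real t * w) y)))) (at t)"
      if "x \<in> K" for x
    proof -
      have "((\<lambda>t. f (of_real t * w) x \<bullet> f (of_real t * w) x) has_derivative
         (\<lambda>s. f (of_real t * w) x \<bullet> (s *\<^sub>R (w * (\<Sum>y\<in>K. M (of_real t * w) x y * f (of_real t * w) y)))
            + (s *\<^sub>R (w * (\<Sum>y\<in>K. M (of_real t * w) x y * f (of_real t * w) y))) \<bullet> f (of_real t * w) x)) (at t)"
        by (rule has_derivative_inner) (use vd[OF that] in \<open>simp_all add: has_vector_derivative_def\<close>)
      then show ?thesis
        unfolding has_field_derivative_def dot_square_norm[symmetric] power2_norm_eq_inner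
        by (rule has_derivative_eq_rhs) (auto simp: inner_commute algebra_simps fun_eq_iff)
    qed
    then show ?thesis unfolding g_def g'_def by (auto intro!: DERIV_sum)
  qed
  have gnn: "0 \<le> g t" for t unfolding g_def by (simp add: sum_nonneg)
  have g'le: "g' t \<le> 2 * L * g t" if t: "t \<in> {0..1}" for t
  proof -
    let ?F = "\<lambda>x. f (of_real t * w) x" and ?M = "\<lambda>x y. M (of_real t * w) x y"
    have prod: "cmod (?F x) * cmod (?F y) \<le> g t" if "x \<in> K" "y \<in> K" for x y
    proof -
      have le: "cmod (?F x) \<le> sqrt (g t)" if "x \<in> K" for x
        unfolding g_def using that fin
        by (intro real_le_rsqrt member_le_sum[where f = "\<lambda>x. (cmod (?F x))\<^sup>2"]) auto
      have "cmod (?F x) * cmod (?F y) \<le> sqrt (g t) * sqrt (g t)"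
        using le that by (intro mult_mono) (auto simp: gnn)
      then show ?thesis using gnn[of t] by simp
    qed
    have "g' t \<le> (\<Sum>x\<in>K. 2 * (\<Sum>y\<in>K. cmod (w * ?M x y) * g t))"
      unfolding g'_def
    proof (intro sum_mono mult_left_mono)
      fix x assume x: "x \<in> K"
      have "?F x \<bullet> (w * (\<Sum>y\<in>K. ?M x y * ?F y)) \<le> cmod (?F x) * cmod (w * (\<Sum>y\<in>K. ?M x y * ?F y))"
        using Cauchy_Schwarz_ineq2 abs_le_D1 by blast
      also have "\<dots> \<le> cmod (?F x) * (\<Sum>y\<in>K. cmod (w * ?M x y) * cmod (?F y))"
        unfolding sum_distrib_left[of w]
        by (intro mult_left_mono order_trans[OF norm_sum] sum_mono) (auto simp: norm_mult mult.assoc)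
      also have "\<dots> = (\<Sum>y\<in>K. cmod (w * ?M x y) * (cmod (?F x) * cmod (?F y)))"
        by (simp add: sum_distrib_left mult_ac)
      also have "\<dots> \<le> (\<Sum>y\<in>K. cmod (w * ?M x y) * g t)"
        by (intro sum_mono mult_left_mono prod x) auto
      finally show "?F x \<bullet> (w * (\<Sum>y\<in>K. ?M x y * ?F y)) \<le> (\<Sum>y\<in>K. cmod (w * ?M x y) * g t)" .
    qed auto
    also have "\<dots> = 2 * B t * g t"
      unfolding B_def by (simp add: sum_distrib_left sum_distrib_right mult_ac)
    also have "\<dots> \<le> 2 * L * g t"
      using L[OF t] gnn[of t] by (intro mult_right_mono) auto
    finally show ?thesis .
  qed
  \<comment> \<open>The integrating factor turns the differential inequality into monotonicity on
    the unit interval.\<close>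
  have "exp (- 2 * L * 1) * g 1 \<le> exp (- 2 * L * 0) * g 0"
  proof (rule DERIV_nonpos_imp_nonincreasing[of 0 1 "\<lambda>t. exp (- 2 * L * t) * g t"])
    fix t :: real assume t: "0 \<le> t" "t \<le> 1"
    have "((\<lambda>t. exp (- 2 * L * t) * g t) has_real_derivative
        exp (- 2 * L * t) * (g' t - 2 * L * g t)) (at t)"
      by (rule derivative_eq_intros gd | simp add: algebra_simps)+
    moreover have "exp (- 2 * L * t) * (g' t - 2 * L * g t) \<le> 0"
      using g'le[of t] t by (intro mult_nonneg_nonpos) auto
    ultimately show "\<exists>y. DERIV (\<lambda>t. exp (- 2 * L * t) * g t) t :> y \<and> y \<le> 0" by blast
  qed simp
  moreover have "g 0 = 0" unfolding g_def by (simp add: init)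
  ultimately have "g 1 \<le> 0" by (simp add: mult_le_0_iff)
  then have "g 1 = 0" using gnn[of 1] by linarith
  then have "(cmod (f (of_real 1 * w) x))\<^sup>2 = 0"
    unfolding g_def using fin x by (subst (asm) sum_nonneg_eq_0_iff) auto
  then show ?thesis by simp
qed

text \<open>With \<open>E = I - X\<close> one has \<open>a = X a + E a\<close>. As \<open>E\<close>
  tends to 0, the term \<open>E a\<close> is first absorbed to bound \<open>a\<close>, and then
  tends to 0 itself.\<close>

lemma tendsto_of_tendsto_near_identity:
  fixes X :: "'t \<Rightarrow> 'k \<Rightarrow> 'k \<Rightarrow> complex"
  assumes fin: "finite K"
    and X: "\<And>x y. x \<in> K \<Longrightarrow> y \<in> K \<Longrightarrow> ((\<lambda>t. X t x y) \<longlongrightarrow> (if x = y then 1 else 0)) G"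
    and b: "\<And>x. x \<in> K \<Longrightarrow> ((\<lambda>t. \<Sum>y\<in>K. X t x y * a t y) \<longlongrightarrow> b x) G"
    and x: "x \<in> K"
  shows "((\<lambda>t. a t x) \<longlongrightarrow> b x) G"
proof -
  define E where "E = (\<lambda>t x y. (if x = y then 1 else 0) - X t x y)"
  define Xa where "Xa = (\<lambda>t x. \<Sum>y\<in>K. X t x y * a t y)"
  define s where "s = (\<lambda>t. \<Sum>x\<in>K. cmod (a t x))"
  have E0: "((\<lambda>t. E t x y) \<longlongrightarrow> 0) G" if "x \<in> K" "y \<in> K" for x y
    using tendsto_diff[OF tendsto_const[of "if x = y then 1 else 0"] X[OF that]]
    unfolding E_def by simp
  have a_eq: "a t x = Xa t x + (\<Sum>y\<in>K. E t x y * a t y)" if "x \<in> K" for t x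
  proof -
    have "(\<Sum>y\<in>K. E t x y * a t y) = (\<Sum>y\<in>K. (if x = y then a t y else 0)) - Xa t x"
      unfolding E_def Xa_def sum_subtractf[symmetric]
      by (intro sum.cong refl) (simp add: left_diff_distrib)
    then show ?thesis using that fin by simp
  qed
  have "((\<lambda>t. \<Sum>x\<in>K. \<Sum>y\<in>K. cmod (E t x y)) \<longlongrightarrow> (\<Sum>x\<in>K. \<Sum>y\<in>K. 0)) G"
    using E0 by (intro tendsto_sum tendsto_norm_zero) auto
  then have "\<forall>\<^sub>F t in G. (\<Sum>x\<in>K. \<Sum>y\<in>K. cmod (E t x y)) < 1/2"
    by (intro order_tendstoD) auto
  moreover have "((\<lambda>t. \<Sum>x\<in>K. cmod (Xa t x)) \<longlongrightarrow> (\<Sum>x\<in>K. cmod (b x))) G"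
    unfolding Xa_def using b by (intro tendsto_sum tendsto_norm) auto
  then have "\<forall>\<^sub>F t in G. (\<Sum>x\<in>K. cmod (Xa t x)) < (\<Sum>x\<in>K. cmod (b x)) + 1"
    by (intro order_tendstoD) auto
  \<comment> \<open>Once the entries of \<open>E\<close> sum to less than 1/2 in modulus,
    \<open>s \<le> |X a| + s/2\<close>, which bounds \<open>s\<close> by twice the size of
    \<open>X a\<close>.\<close>
  ultimately have bdd: "\<forall>\<^sub>F t in G. s t \<le> 2 * (\<Sum>x\<in>K. cmod (b x)) + 2"
  proof eventually_elim
    case (elim t)
    have le: "cmod (a t y) \<le> s t" if "y \<in> K" for y
      unfolding s_def using fin that by (intro member_le_sum[where f = "\<lambda>y. cmod (a t y)"]) auto
    have s0: "0 \<le> s t" unfolding s_def by (simp add: sum_nonneg)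
    have "s t = (\<Sum>x\<in>K. cmod (a t x))" by (simp add: s_def)
    also have "\<dots> \<le> (\<Sum>x\<in>K. cmod (Xa t x) + (\<Sum>y\<in>K. cmod (E t x y) * s t))"
    proof (rule sum_mono)
      fix x assume x: "x \<in> K"
      have "cmod (a t x) \<le> cmod (Xa t x) + cmod (\<Sum>y\<in>K. E t x y * a t y)"
        unfolding a_eq[OF x, of t] by (rule norm_triangle_ineq)
      also have "cmod (\<Sum>y\<in>K. E t x y * a t y) \<le> (\<Sum>y\<in>K. cmod (E t x y) * s t)"
        by (intro order_trans[OF norm_sum] sum_mono) (auto simp: norm_mult intro!: mult_left_mono le)
      finally show "cmod (a t x) \<le> cmod (Xa t x) + (\<Sum>y\<in>K. cmod (E t x y) * s t)" by simp
    qed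
    also have "\<dots> = (\<Sum>x\<in>K. cmod (Xa t x)) + (\<Sum>x\<in>K. \<Sum>y\<in>K. cmod (E t x y)) * s t"
      by (simp add: sum.distrib sum_distrib_right)
    also have "\<dots> \<le> (\<Sum>x\<in>K. cmod (b x)) + 1 + 1/2 * s t"
      using elim s0 by (intro add_mono mult_right_mono) auto
    finally show ?case by simp
  qed
  have small: "((\<lambda>t. E t x y * a t y) \<longlongrightarrow> 0) G" if "y \<in> K" for y
  proof (rule Lim_null_comparison)
    show "\<forall>\<^sub>F t in G. cmod (E t x y * a t y) \<le> cmod (E t x y) * (2 * (\<Sum>x\<in>K. cmod (b x)) + 2)"
      using bdd
    proof eventually_elim
      case (elim t)
      have "cmod (a t y) \<le> s t"
        unfolding s_def using fin that by (intro member_le_sum[where f = "\<lambda>y. cmod (a t y)"]) auto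
      then show ?case using elim by (auto simp: norm_mult intro!: mult_left_mono)
    qed
    show "((\<lambda>t. cmod (E t x y) * (2 * (\<Sum>x\<in>K. cmod (b x)) + 2)) \<longlongrightarrow> 0) G"
      by (intro tendsto_mult_left_zero tendsto_norm_zero E0 x that)
  qed
  have "((\<lambda>t. Xa t x + (\<Sum>y\<in>K. E t x y * a t y)) \<longlongrightarrow> b x + (\<Sum>y\<in>K. 0)) G"
    unfolding Xa_def using b x small by (intro tendsto_add tendsto_sum) auto
  then show ?thesis using a_eq[OF x] by simp
qed

section \<open>Expansions in powers of \<open>1/z\<close> along a single ray\<close>

definition ray_expansion :: "(complex \<Rightarrow> complex) \<Rightarrow> (nat \<Rightarrow> complex) \<Rightarrow> real \<Rightarrow> bool" where
  "ray_expansion f c \<theta> \<longleftrightarrow> (\<forall>N. \<exists>C \<rho>. \<forall>w. Im w = \<theta> \<and> cmod (exp w) \<ge> \<rho> \<longrightarrow>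
     cmod (f w - (\<Sum>t<N. c t / exp w ^ t)) \<le> C / cmod (exp w) ^ N)"

text \<open>The bound of order \<open>N + 1\<close>, multiplied by \<open>z^N\<close>, leaves an
  error of size \<open>1/|z|\<close> around \<open>c N\<close>.\<close>

lemma ray_expansion_remainder:
  assumes "ray_expansion f c \<theta>"
  shows "((\<lambda>r. (f (Complex r \<theta>) - (\<Sum>t<N. c t / exp (Complex r \<theta>) ^ t)) * exp (Complex r \<theta>) ^ N) \<longlongrightarrow> c N) at_top"
proof -
  obtain C \<rho> where C: "\<And>w. Im w = \<theta> \<Longrightarrow> cmod (exp w) \<ge> \<rho> \<Longrightarrow>
     cmod (f w - (\<Sum>t<Suc N. c t / exp w ^ t)) \<le> C / cmod (exp w) ^ Suc N"
    using assms unfolding ray_expansion_def by meson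
  have "\<forall>\<^sub>F r::real in at_top. exp r \<ge> \<rho>" by real_asymp
  then have "\<forall>\<^sub>F r in at_top. cmod ((f (Complex r \<theta>) - (\<Sum>t<N. c t / exp (Complex r \<theta>) ^ t)) * exp (Complex r \<theta>) ^ N - c N) \<le> C * exp (-r)"
  proof eventually_elim
    case (elim r)
    let ?w = "Complex r \<theta>"
    have "(f ?w - (\<Sum>t<N. c t / exp ?w ^ t)) * exp ?w ^ N - c N = (f ?w - (\<Sum>t<Suc N. c t / exp ?w ^ t)) * exp ?w ^ N"
      by (simp add: field_simps)
    then have "cmod ((f ?w - (\<Sum>t<N. c t / exp ?w ^ t)) * exp ?w ^ N - c N) = cmod (f ?w - (\<Sum>t<Suc N. c t / exp ?w ^ t)) * exp r ^ N"
      by (simp add: norm_mult norm_power)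
    also have "\<dots> \<le> C / exp r ^ Suc N * exp r ^ N"
      using C[of ?w] elim by (intro mult_right_mono) (auto)
    also have "\<dots> = C * exp (-r)" by (simp add: exp_minus field_simps)
    finally show ?case .
  qed
  moreover have "((\<lambda>r::real. C * exp (- r)) \<longlongrightarrow> 0) at_top" by real_asymp
  ultimately show ?thesis by (rule LIM_zero_cancel[OF Lim_null_comparison])
qed

lemma ray_expansion_tendsto:
  assumes "ray_expansion f c \<theta>"
  shows "((\<lambda>r. f (Complex r \<theta>)) \<longlongrightarrow> c 0) at_top"
  using ray_expansion_remainder[OF assms, of 0] by simp

text \<open>Translating \<open>r\<close> by \<open>s\<close> keeps the limit but multiplies the
  function by \<open>exp (g s)\<close>. Hence \<open>exp (g s) = 1\<close> for all real
  \<open>s\<close>, and the derivative at 0 gives \<open>g = 0\<close>.\<close>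

lemma exp_ray_tendsto_nonzero_imp_zero:
  assumes "((\<lambda>r. exp (g * Complex r \<theta>)) \<longlongrightarrow> l) at_top" "l \<noteq> 0"
  shows "g = 0"
proof -
  have "exp (g * of_real s) = 1" for s :: real
  proof -
    have "filterlim (\<lambda>r::real. r + s) at_top at_top"
      by real_asymp
    from filterlim_compose[OF assms(1) this]
    have "((\<lambda>r. exp (g * Complex (r + s) \<theta>)) \<longlongrightarrow> l) at_top" .
    moreover have "exp (g * Complex (r + s) \<theta>) = exp (g * of_real s) * exp (g * Complex r \<theta>)" for r
      by (simp add: exp_add[symmetric] complex_eq_iff algebra_simps complex_add[symmetric])
         (simp add: complex_eq_iff Complex_eq algebra_simps)
    ultimately have "((\<lambda>r. exp (g * of_real s) * exp (g * Complex r \<theta>)) \<longlongrightarrow> l) at_top" by simp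
    moreover have "((\<lambda>r. exp (g * of_real s) * exp (g * Complex r \<theta>)) \<longlongrightarrow> exp (g * of_real s) * l) at_top"
      by (intro tendsto_mult tendsto_const assms)
    ultimately have "exp (g * of_real s) * l = l"
      using tendsto_unique trivial_limit_at_top_linorder by blast
    then show ?thesis using assms(2) by simp
  qed
  then have "(\<lambda>s::real. exp (g * of_real s)) = (\<lambda>s. 1)" by auto
  moreover have "((\<lambda>s::real. exp (g * of_real s)) has_vector_derivative g) (at 0)"
    using exp_scaleR_has_vector_derivative_right[of g 0 UNIV]
    by (simp add: scaleR_conv_of_real mult.commute)
  ultimately show ?thesis
    by (metis has_vector_derivative_const vector_derivative_at)
qed

text \<open>If \<open>c N\<close> is the first nonzero coefficient, \<open>f\<close> behaves like
  \<open>c N z^(-N)\<close>, and a nonzero limit would force \<open>g = -N\<close>. If all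
  coefficients vanish, \<open>f\<close> decays faster than every power and the limit is 0.\<close>

lemma ray_expansion_noninteger_power:
  assumes f: "ray_expansion f c \<theta>"
    and lim: "((\<lambda>r. k * f (Complex r \<theta>) * exp (- g * Complex r \<theta>)) \<longlongrightarrow> v) at_top"
    and g: "g \<notin> \<int>"
  shows "v = 0"
proof (rule ccontr)
  assume v: "v \<noteq> 0"
  have P: "((\<lambda>r. f (Complex r \<theta>) * exp (Complex r \<theta>) ^ N) \<longlongrightarrow> c N) at_top"
    if "\<And>t. t < N \<Longrightarrow> c t = 0" for N
    using ray_expansion_remainder[OF f, of N] that by simp
  show False
  proof (cases "\<exists>N. c N \<noteq> 0")
    case True
    then obtain N where N: "c N \<noteq> 0" "\<And>t. t < N \<Longrightarrow> c t = 0"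
      using exists_least_iff[of "\<lambda>N. c N \<noteq> 0"] by blast
    have "((\<lambda>r. (k * f (Complex r \<theta>) * exp (- g * Complex r \<theta>)) / (f (Complex r \<theta>) * exp (Complex r \<theta>) ^ N)) \<longlongrightarrow> v / c N) at_top"
      by (intro tendsto_divide lim P N)
    moreover have "\<forall>\<^sub>F r in at_top. f (Complex r \<theta>) * exp (Complex r \<theta>) ^ N \<noteq> 0"
      using P[OF N(2)] N(1) by (rule tendsto_imp_eventually_ne)
    then have "\<forall>\<^sub>F r in at_top. (k * f (Complex r \<theta>) * exp (- g * Complex r \<theta>)) / (f (Complex r \<theta>) * exp (Complex r \<theta>) ^ N) = k * exp ((- g - of_nat N) * Complex r \<theta>)"
      by eventually_elim (simp add: exp_of_nat_mult[symmetric] exp_diff left_diff_distrib)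
    ultimately have *: "((\<lambda>r. k * exp ((- g - of_nat N) * Complex r \<theta>)) \<longlongrightarrow> v / c N) at_top"
      by (rule Lim_transform_eventually)
    have k: "k \<noteq> 0"
    proof
      assume "k = 0" then show False using lim v tendsto_unique[OF _ lim, of 0] by simp
    qed
    have "((\<lambda>r. (k * exp ((- g - of_nat N) * Complex r \<theta>)) / k) \<longlongrightarrow> v / c N / k) at_top"
      using k by (intro tendsto_divide * tendsto_const)
    then have "- g - of_nat N = 0"
      using k v N by (intro exp_ray_tendsto_nonzero_imp_zero[of _ \<theta> "v / c N / k"]) auto
    then have "- g = of_nat N" by simp
    then have "g = - of_nat N" by (metis minus_minus)
    then show False using g by auto
  next
    case False
    \<comment> \<open>With \<open>Re g + N > 0\<close> the power \<open>z^(-g-N)\<close> decays,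
      while \<open>f z^N\<close> tends to 0 as well.\<close>
    obtain N where N: "- Re g < real N" using reals_Archimedean2 by blast
    have "((\<lambda>r. k * (f (Complex r \<theta>) * exp (Complex r \<theta>) ^ N) * exp (- (g + of_nat N) * Complex r \<theta>)) \<longlongrightarrow> k * c N * 0) at_top"
    proof (intro tendsto_mult tendsto_const P)
      have "((\<lambda>r. exp (- (Re g + N) * r + Im g * \<theta>)) \<longlongrightarrow> 0) at_top"
        using N by real_asymp
      then show "((\<lambda>r. exp (- (g + of_nat N) * Complex r \<theta>)) \<longlongrightarrow> 0) at_top"
        by (intro tendsto_norm_zero_cancel[of "\<lambda>r. exp (- (g + of_nat N) * Complex r \<theta>)"]) (simp add: algebra_simps)
    qed (use False in auto)
    moreover have "k * (f (Complex r \<theta>) * exp (Complex r \<theta>) ^ N) * exp (- (g + of_nat N) * Complex r \<theta>) = k * f (Complex r \<theta>) * exp (- g * Complex r \<theta>)" for r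
      by (simp add: exp_of_nat_mult[symmetric] exp_add[symmetric] algebra_simps exp_minus exp_diff)
    ultimately have "((\<lambda>r. k * f (Complex r \<theta>) * exp (- g * Complex r \<theta>)) \<longlongrightarrow> 0) at_top"
      by (simp only: mult_zero_right)
    then show False using lim v tendsto_unique trivial_limit_at_top_linorder by blast
  qed
qed

text \<open>In the coordinate \<open>w = log z\<close> this says that an exponential decaying along
  the ray beats every complex power of \<open>z\<close>.\<close>

lemma exp_exp_ray_tendsto_zero:
  assumes "Re (r0 * cis \<theta>) < 0"
  shows "((\<lambda>r. exp (r0 * exp (Complex r \<theta>) + g * Complex r \<theta>)) \<longlongrightarrow> 0) at_top"
proof -
  have "Re (r0 * exp (Complex r \<theta>)) = Re (r0 * cis \<theta>) * exp r" for r
    by (simp add: exp_eq_polar algebra_simps)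
  then have "cmod (exp (r0 * exp (Complex r \<theta>) + g * Complex r \<theta>)) = exp (Re (r0 * cis \<theta>) * exp r + Re g * r - Im g * \<theta>)" for r
    by simp
  moreover have "((\<lambda>r. exp (Re (r0 * cis \<theta>) * exp r + Re g * r - Im g * \<theta>)) \<longlongrightarrow> 0) at_top"
    using assms by real_asymp
  ultimately show ?thesis
    by (intro tendsto_norm_zero_cancel[of "\<lambda>r. exp (r0 * exp (Complex r \<theta>) + g * Complex r \<theta>)"])
       (simp only:)
qed

text \<open>Multiplying by the reciprocal factor, which decays, recovers the constant
  \<open>v\<close> as a limit equal to 0.\<close>

lemma exp_exp_ray_tendsto_imp_zero:
  assumes "Re (r0 * cis \<theta>) > 0"
    and lim: "((\<lambda>r. exp (r0 * exp (Complex r \<theta>) + g * Complex r \<theta>) * v) \<longlongrightarrow> l) at_top"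
  shows "v = 0"
proof -
  have "((\<lambda>r. exp (- r0 * exp (Complex r \<theta>) + - g * Complex r \<theta>) * (exp (r0 * exp (Complex r \<theta>) + g * Complex r \<theta>) * v)) \<longlongrightarrow> 0 * l) at_top"
    using assms by (intro tendsto_mult lim exp_exp_ray_tendsto_zero) auto
  moreover have "exp (- r0 * exp (Complex r \<theta>) + - g * Complex r \<theta>) * (exp (r0 * exp (Complex r \<theta>) + g * Complex r \<theta>) * v) = v" for r
    unfolding mult.assoc[symmetric] exp_add[symmetric] by simp
  ultimately have "((\<lambda>r::real. v) \<longlongrightarrow> 0) at_top" by (simp only: mult_zero_left)
  then show ?thesis by (simp add: tendsto_const_iff)
qed

subsection \<open>The super tensor product as a matrix algebra\<close>

text \<open>The span of the \<open>E_ii \<otimes> E_kk\<close>. The unit, \<open>U\<close>,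
  \<open>deltaP\<close> and their exponentials lie in it. Its elements are even, so multiplying by
  them from either side produces no sign.\<close>

definition diagT :: "nat \<Rightarrow> nat \<Rightarrow> (nat \<Rightarrow> nat \<Rightarrow> complex) \<Rightarrow> tens" where
  "diagT m n c = (\<lambda>i j k l. if i = j \<and> k = l \<and> i \<in> {1..m+n} \<and> k \<in> {1..m+n} then c i k else 0)"

lemma sum_fun_apply: "(\<Sum>a\<in>A. f a) x = (\<Sum>a\<in>A. f a x :: 'b :: comm_monoid_add)"
  by (induction A rule: infinite_finite_induct) auto

lemma sum_tens_apply: "(\<Sum>a\<in>A. f a) i j k l = (\<Sum>a\<in>A. (f a :: tens) i j k l)"
  by (simp only: sum_fun_apply)

lemma uminus_tens_apply: "(- A) i j k l = - (A :: tens) i j k l"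
  by simp

lemma tmult_diagT_left:
  "tmult m n (diagT m n c) A i j k l =
     (if i \<in> {1..m+n} \<and> k \<in> {1..m+n} then c i k * A i j k l else 0)"
proof -
  have "tmult m n (diagT m n c) A i j k l = (\<Sum>p = 1..m+n. \<Sum>r = 1..m+n.
      if p = i then (if r = k then diagT m n c i i k k * A i j k l else 0) else 0)"
    unfolding tmult_def
    by (intro sum.cong refl) (auto simp: diagT_def minus_one_power_iff)
  also have "\<dots> = (\<Sum>p = 1..m+n. if p = i then
      if k \<in> {1..m+n} then diagT m n c i i k k * A i j k l else 0 else 0)"
    by (intro sum.cong refl) auto
  also have "\<dots> = (if i \<in> {1..m+n} \<and> k \<in> {1..m+n} then c i k * A i j k l else 0)"
    by (auto simp: diagT_def)
  finally show ?thesis .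
qed

lemma tmult_diagT_right:
  "tmult m n A (diagT m n c) i j k l =
     (if j \<in> {1..m+n} \<and> l \<in> {1..m+n} then A i j k l * c j l else 0)"
proof -
  have "tmult m n A (diagT m n c) i j k l = (\<Sum>p = 1..m+n. \<Sum>r = 1..m+n.
      if p = j then (if r = l then A i j k l * diagT m n c j j l l else 0) else 0)"
    unfolding tmult_def
    by (intro sum.cong refl) (auto simp: diagT_def minus_one_power_iff)
  also have "\<dots> = (\<Sum>p = 1..m+n. if p = j then
      if l \<in> {1..m+n} then A i j k l * diagT m n c j j l l else 0 else 0)"
    by (intro sum.cong refl) auto
  also have "\<dots> = (if j \<in> {1..m+n} \<and> l \<in> {1..m+n} then A i j k l * c j l else 0)"
    by (auto simp: diagT_def)
  finally show ?thesis .
qed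

lemma tone_eq_diagT: "tone m n = diagT m n (\<lambda>_ _. 1)"
proof (intro ext)
  fix i j k l
  have "tone m n i j k l = (\<Sum>a = 1..m+n. \<Sum>b = 1..m+n.
      if a = i then (if b = k then (if i = j \<and> k = l then 1 else 0) else 0) else 0)"
    unfolding tone_def sum_tens_apply by (intro sum.cong refl) (auto simp: EE_def)
  also have "\<dots> = (\<Sum>a = 1..m+n. if a = i then
      (if k \<in> {1..m+n} then (if i = j \<and> k = l then 1 else 0) else 0) else 0)"
    by (intro sum.cong refl) auto
  also have "\<dots> = diagT m n (\<lambda>_ _. 1) i j k l"
    by (auto simp: diagT_def)
  finally show "tone m n i j k l = diagT m n (\<lambda>_ _. 1) i j k l" .
qed

lemma Umat_eq_diagT: "Umat m n u = diagT m n (\<lambda>_ k. u k)"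
proof (intro ext)
  fix i j k l
  have "Umat m n u i j k l = (\<Sum>a = 1..m+n. \<Sum>b = 1..m+n.
      if a = k then (if b = i then (if i = j \<and> k = l then u k else 0) else 0) else 0)"
    unfolding Umat_def sum_tens_apply by (intro sum.cong refl) (auto simp: EE_def tscale_def)
  also have "\<dots> = (\<Sum>a = 1..m+n. if a = k then
      (if i \<in> {1..m+n} then (if i = j \<and> k = l then u k else 0) else 0) else 0)"
    by (intro sum.cong refl) auto
  also have "\<dots> = diagT m n (\<lambda>_ k. u k) i j k l"
    by (auto simp: diagT_def)
  finally show "Umat m n u i j k l = diagT m n (\<lambda>_ k. u k) i j k l" .
qed

lemma deltaP_eq_diagT: "deltaP m n = diagT m n (\<lambda>i k. if i = k then - ((-1) ^ par m i) else 0)"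
proof (intro ext)
  fix i j k l
  have "deltaP m n i j k l = - (\<Sum>a = 1..m+n.
      if a = i then (if i = j \<and> k = l \<and> i = k then (-1) ^ par m i else 0) else 0)"
    unfolding deltaP_def uminus_tens_apply sum_tens_apply
    by (rule arg_cong[of _ _ uminus], rule sum.cong) (auto simp: EE_def tscale_def)
  also have "\<dots> = diagT m n (\<lambda>i k. if i = k then - ((-1) ^ par m i) else 0) i j k l"
    by (auto simp: diagT_def)
  finally show "deltaP m n i j k l = diagT m n (\<lambda>i k. if i = k then - ((-1) ^ par m i) else 0) i j k l" .
qed

lemma Pmat_apply: "Pmat m n i j k l =
  (if j = k \<and> l = i \<and> i \<in> {1..m+n} \<and> k \<in> {1..m+n} then - ((-1) ^ par m k) else 0)"
proof -
  have "Pmat m n i j k l = - (\<Sum>a = 1..m+n. \<Sum>b = 1..m+n.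
      if a = i then (if b = k then (if j = k \<and> l = i then (-1) ^ par m k else 0) else 0) else 0)"
    unfolding Pmat_def uminus_tens_apply sum_tens_apply
    by (rule arg_cong[of _ _ uminus], intro sum.cong refl) (auto simp: EE_def tscale_def)
  also have "\<dots> = - (\<Sum>a = 1..m+n. if a = i then
      (if k \<in> {1..m+n} then (if j = k \<and> l = i then (-1) ^ par m k else 0) else 0) else 0)"
    by (rule arg_cong[of _ _ uminus], intro sum.cong refl) auto
  also have "\<dots> = (if j = k \<and> l = i \<and> i \<in> {1..m+n} \<and> k \<in> {1..m+n} then - ((-1) ^ par m k) else 0)"
    by auto
  finally show ?thesis .
qed

lemma Rmat_apply:
  assumes "i \<in> {1..m+n}" "j \<in> {1..m+n}" "k \<in> {1..m+n}" "l \<in> {1..m+n}"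
  shows "Rmat m n q i j k l =
     (if i = j \<and> k = l then (if i = k then q powi ((-1) ^ par m i) else 1)
      else if j = k \<and> l = i \<and> k < i then (q - inverse q) * (-1) ^ par m k else 0)"
proof -
  have fin: "finite {(i, j). i \<in> {1..m+n} \<and> j \<in> {1..m+n} \<and> Q i j}" for Q
    by (rule finite_subset[of _ "{1..m+n} \<times> {1..m+n}"]) auto
  have 1: "(\<Sum>a = 1..m+n. tscale (q powi ((-1) ^ par m a)) (EE a a a a)) i j k l
     = (if i = j \<and> k = l \<and> i = k then q powi ((-1) ^ par m i) else 0)"
  proof -
    have "(\<Sum>a = 1..m+n. tscale (q powi ((-1) ^ par m a)) (EE a a a a)) i j k l
      = (\<Sum>a = 1..m+n. if a = i then (if i = j \<and> k = l \<and> i = k then q powi ((-1) ^ par m i) else 0) else 0)"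
      unfolding sum_tens_apply by (intro sum.cong refl) (auto simp: EE_def tscale_def)
    then show ?thesis using assms by simp
  qed
  have 2: "(\<Sum>(a, b) \<in> {(i, j). i \<in> {1..m+n} \<and> j \<in> {1..m+n} \<and> i \<noteq> j}. EE a a b b) i j k l
     = (if i = j \<and> k = l \<and> i \<noteq> k then 1 else 0)"
  proof -
    have "(\<Sum>(a, b) \<in> {(i, j). i \<in> {1..m+n} \<and> j \<in> {1..m+n} \<and> i \<noteq> j}. EE a a b b) i j k l
      = (\<Sum>x \<in> {(i, j). i \<in> {1..m+n} \<and> j \<in> {1..m+n} \<and> i \<noteq> j}. if x = (i, k) then (if i = j \<and> k = l then 1 else 0) else 0)"
      unfolding sum_tens_apply by (intro sum.cong refl) (auto simp: EE_def split: if_splits)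
    then show ?thesis using assms fin[of "\<lambda>i j. i \<noteq> j"] by (simp add: sum.delta)
  qed
  have 3: "(\<Sum>(a, b) \<in> {(i, j). i \<in> {1..m+n} \<and> j \<in> {1..m+n} \<and> i < j}. tscale ((-1) ^ par m a) (EE b a a b)) i j k l
     = (if j = k \<and> l = i \<and> k < i then (-1) ^ par m k else 0)"
  proof -
    have "(\<Sum>(a, b) \<in> {(i, j). i \<in> {1..m+n} \<and> j \<in> {1..m+n} \<and> i < j}. tscale ((-1) ^ par m a) (EE b a a b)) i j k l
      = (\<Sum>x \<in> {(i, j). i \<in> {1..m+n} \<and> j \<in> {1..m+n} \<and> i < j}. if x = (k, i) then (if j = k \<and> l = i then (-1) ^ par m k else 0) else 0)"
      unfolding sum_tens_apply by (intro sum.cong refl) (auto simp: EE_def tscale_def split: if_splits)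
    then show ?thesis using assms fin[of "\<lambda>i j. i < j"] by (simp add: sum.delta)
  qed
  show ?thesis
    unfolding Rmat_def plus_fun_apply 1 2 tscale_def[of "q - inverse q"] 3 by auto
qed

lemma tscale_diagT: "tscale s (diagT m n c) = diagT m n (\<lambda>i k. s * c i k)"
  by (auto simp: tscale_def diagT_def fun_eq_iff)

lemma tpow_diagT: "tpow m n (diagT m n c) t = diagT m n (\<lambda>i k. c i k ^ t)"
proof (induction t)
  case 0
  then show ?case by (simp add: tone_eq_diagT)
next
  case (Suc t)
  show ?case
    by (intro ext) (simp add: Suc tmult_diagT_left, simp add: diagT_def)
qed

lemma texp_diagT: "texp m n (diagT m n c) = diagT m n (\<lambda>i k. exp (c i k))"
proof (intro ext)
  fix i j k l
  show "texp m n (diagT m n c) i j k l = diagT m n (\<lambda>i k. exp (c i k)) i j k l"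
  proof (cases "i = j \<and> k = l \<and> i \<in> {1..m+n} \<and> k \<in> {1..m+n}")
    case True
    then have "diagT m n c' i j k l = c' i k" for c'
      by (simp add: diagT_def)
    then show ?thesis
      by (simp add: texp_def tpow_diagT exp_def scaleR_conv_of_real divide_inverse mult.commute)
  next
    case False
    then have "diagT m n c' i j k l = 0" for c'
      unfolding diagT_def by (rule if_not_P[OF contrapos_nn]) blast
    then show ?thesis
      by (simp add: texp_def tpow_diagT)
  qed
qed

section \<open>The sign twist to matrices indexed by pairs\<close>

type_synonym pmat = "nat \<times> nat \<Rightarrow> nat \<times> nat \<Rightarrow> complex"

definition idx :: "nat \<Rightarrow> nat \<Rightarrow> (nat \<times> nat) set" where
  "idx m n = {1..m+n} \<times> {1..m+n}"

text \<open>
  The action of \<open>E\<^sub>i\<^sub>j \<otimes> E\<^sub>k\<^sub>l\<close> on \<open>v\<^sub>j \<otimes> v\<^sub>l\<close> produces the sign \<open>(-1)\<^bsup>|E\<^sub>k\<^sub>l||v\<^sub>j|\<^esup>\<close>.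
\<close>

definition tw :: "nat \<Rightarrow> tens \<Rightarrow> pmat" where
  "tw m A x y = (-1) ^ ((par m (snd x) + par m (snd y)) * par m (fst y)) *
     A (fst x) (fst y) (snd x) (snd y)"

text \<open>The sign of the super flip
  \<open>v_i \<otimes> v_k \<mapsto> (-1)^(|i||k|) v_k \<otimes> v_i\<close>.\<close>

definition eps :: "nat \<Rightarrow> nat \<times> nat \<Rightarrow> complex" where
  "eps m x = (-1) ^ (par m (fst x) * par m (snd x))"

text \<open>The diagonal entries of \<open>deltaP\<close>; they vanish at pairs with two different
  components.\<close>

definition dlt :: "nat \<Rightarrow> nat \<times> nat \<Rightarrow> complex" where
  "dlt m x = (if fst x = snd x then - ((-1) ^ par m (fst x)) else 0)"

lemma finite_idx [simp]: "finite (idx m n)"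
  by (simp add: idx_def)

lemma swap_idx [simp]: "prod.swap x \<in> idx m n \<longleftrightarrow> x \<in> idx m n"
  by (cases x) (auto simp: idx_def)

lemma eps_swap [simp]: "eps m (prod.swap x) = eps m x"
  by (simp add: eps_def mult.commute)

text \<open>The twist is the action on the tensor square of the super vector space, hence
  multiplicative. In terms of parities the signs agree because \<open>(k+l)j + (k+r)(p+j)\<close>
  and \<open>(k+r)p + (r+l)j\<close> are congruent modulo 2.\<close>

lemma tw_tmult: "tw m (tmult m n A B) x y = (\<Sum>z\<in>idx m n. tw m A x z * tw m B z y)"
proof -
  obtain i k j l where xy: "x = (i, k)" "y = (j, l)" by fastforce
  have sgn: "(-1::complex) ^ ((par m k + par m l) * par m j) * (-1) ^ ((par m k + par m r) * (par m p + par m j))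
     = (-1) ^ ((par m k + par m r) * par m p) * (-1) ^ ((par m r + par m l) * par m j)" for p r
    by (auto simp: minus_one_power_iff)
  have "tw m (tmult m n A B) x y = (\<Sum>p = 1..m+n. \<Sum>r = 1..m+n. tw m A x (p, r) * tw m B (p, r) y)"
    unfolding tw_def tmult_def xy fst_conv snd_conv sum_distrib_left
  proof (intro sum.cong refl)
    fix p r
    show "(-1) ^ ((par m k + par m l) * par m j) * ((-1) ^ ((par m k + par m r) * (par m p + par m j)) * A i p k r * B p j r l)
      = (-1) ^ ((par m k + par m r) * par m p) * A i p k r * ((-1) ^ ((par m r + par m l) * par m j) * B p j r l)"
      using arg_cong[OF sgn[of r p], of "\<lambda>s. s * A i p k r * B p j r l"] by (simp add: mult_ac)
  qed
  then show ?thesis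
    by (simp add: idx_def sum.cartesian_product case_prod_unfold)
qed

lemma tw_diagT: "tw m (diagT m n c) x y = (if x = y \<and> x \<in> idx m n then c (fst x) (snd x) else 0)"
  by (cases x; cases y) (auto simp: tw_def diagT_def idx_def minus_one_power_iff)

lemma tw_tone: "tw m (tone m n) x y = (if x = y \<and> x \<in> idx m n then 1 else 0)"
  by (simp add: tone_eq_diagT tw_diagT)

lemma tw_Pmat: "tw m (Pmat m n) x y = (if y = prod.swap x \<and> x \<in> idx m n then - eps m x else 0)"
  by (cases x; cases y) (auto simp: tw_def Pmat_apply idx_def eps_def minus_one_power_iff)

text \<open>At \<open>x = (j,i)\<close> with \<open>i < j\<close> the twist contributes
  \<open>(-1)^((i+j)i)\<close> and the coefficient \<open>(-1)^i\<close>; their product is the flip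
  sign \<open>(-1)^(ij)\<close>.\<close>

lemma tw_Rmat:
  assumes "x \<in> idx m n" "y \<in> idx m n"
  shows "tw m (Rmat m n q) x y =
     (if x = y then (if fst x = snd x then q powi ((-1) ^ par m (fst x)) else 1)
      else if y = prod.swap x \<and> snd x < fst x then (q - inverse q) * eps m x else 0)"
  using assms by (cases x; cases y)
    (auto simp: tw_def Rmat_apply idx_def eps_def minus_one_power_iff)

lemma tens_eqI:
  assumes "A \<in> tens_carrier m n" "B \<in> tens_carrier m n"
    and "\<And>x y. x \<in> idx m n \<Longrightarrow> y \<in> idx m n \<Longrightarrow> tw m A x y = tw m B x y"
  shows "A = B"
proof (intro ext)
  fix i j k l
  show "A i j k l = B i j k l"
  proof (cases "(i, k) \<in> idx m n \<and> (j, l) \<in> idx m n")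
    case True
    then show ?thesis using assms(3)[of "(i, k)" "(j, l)"] by (simp add: tw_def)
  next
    case False
    then have "A i j k l = 0" "B i j k l = 0"
      using assms(1,2) unfolding tens_carrier_def idx_def by (auto; blast)+
    then show ?thesis by simp
  qed
qed

lemma tmult_carrier:
  assumes "A \<in> tens_carrier m n" "B \<in> tens_carrier m n"
  shows "tmult m n A B \<in> tens_carrier m n"
  unfolding tens_carrier_def mem_Collect_eq
proof (intro allI impI)
  fix i j k l assume "tmult m n A B i j k l \<noteq> 0"
  then obtain p r where "A i p k r \<noteq> 0" "B p j r l \<noteq> 0"
    unfolding tmult_def by (auto elim!: sum.not_neutral_contains_not_neutral)
  then show "i \<in> {1..m+n} \<and> j \<in> {1..m+n} \<and> k \<in> {1..m+n} \<and> l \<in> {1..m+n}"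
    using assms unfolding tens_carrier_def by blast
qed

lemma diagT_carrier: "diagT m n c \<in> tens_carrier m n"
  by (auto simp: tens_carrier_def diagT_def)

lemma Rmat_carrier: "Rmat m n q \<in> tens_carrier m n"
proof -
  have EE0: "EE a b c d i j k l \<noteq> 0 \<longleftrightarrow> a = i \<and> b = j \<and> c = k \<and> d = l" for a b c d i j k l
    by (auto simp: EE_def)
  show ?thesis
    unfolding tens_carrier_def mem_Collect_eq
  proof (intro allI impI)
    fix i j k l assume *: "Rmat m n q i j k l \<noteq> 0"
    have "(\<Sum>a = 1..m+n. tscale (q powi ((-1) ^ par m a)) (EE a a a a) i j k l) \<noteq> 0 \<or>
       (\<Sum>x \<in> {(i, j). i \<in> {1..m+n} \<and> j \<in> {1..m+n} \<and> i \<noteq> j}. (case x of (a, b) \<Rightarrow> EE a a b b) i j k l) \<noteq> 0 \<or>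
       (\<Sum>x \<in> {(i, j). i \<in> {1..m+n} \<and> j \<in> {1..m+n} \<and> i < j}. (case x of (a, b) \<Rightarrow> tscale ((-1) ^ par m a) (EE b a a b)) i j k l) \<noteq> 0"
      using * unfolding Rmat_def plus_fun_apply tscale_def[of "q - inverse q"] sum_tens_apply by auto
    then show "i \<in> {1..m+n} \<and> j \<in> {1..m+n} \<and> k \<in> {1..m+n} \<and> l \<in> {1..m+n}"
      by (elim disjE; elim sum.not_neutral_contains_not_neutral) (auto simp: tscale_def EE0)
  qed
qed

subsection \<open>Canonical solutions\<close>

text \<open>The twisted system for a single column in the coordinate \<open>w = log z\<close>. The
  pole term couples \<open>x\<close> only with \<open>prod.swap x\<close>, which is the source of
  the block structure.\<close>

definition swap_solution ::
  "nat \<Rightarrow> nat \<Rightarrow> complex \<Rightarrow> (nat \<Rightarrow> complex) \<Rightarrow> (complex \<Rightarrow> nat \<times> nat \<Rightarrow> complex) \<Rightarrow> bool" where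
  "swap_solution m n h u f \<longleftrightarrow> (\<forall>w. \<forall>x\<in>idx m n. ((\<lambda>w. f w x) has_field_derivative
     exp w * h * u (snd x) * f w x - h * eps m x * f w (prod.swap x)) (at w))"

definition swap_fundamental ::
  "nat \<Rightarrow> nat \<Rightarrow> complex \<Rightarrow> (nat \<Rightarrow> complex) \<Rightarrow> (complex \<Rightarrow> pmat) \<Rightarrow> bool" where
  "swap_fundamental m n h u F \<longleftrightarrow> (\<forall>y\<in>idx m n. swap_solution m n h u (\<lambda>w x. F w x y)) \<and>
     (\<forall>w. \<exists>G. \<forall>x\<in>idx m n. \<forall>y\<in>idx m n.
        (\<Sum>z\<in>idx m n. F w x z * G z y) = (if x = y then 1 else 0) \<and>
        (\<Sum>z\<in>idx m n. G x z * F w z y) = (if x = y then 1 else 0))"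

text \<open>The entries of \<open>F z^(-h deltaP) e^(-hUz)\<close>: both factors are diagonal and
  therefore rescale the columns of \<open>F\<close>.\<close>

definition normalized ::
  "nat \<Rightarrow> complex \<Rightarrow> (nat \<Rightarrow> complex) \<Rightarrow> (complex \<Rightarrow> pmat) \<Rightarrow> complex \<Rightarrow> pmat" where
  "normalized m h u F w x y = F w x y * exp (- h * w * dlt m y) * exp (- h * exp w * u (snd y))"

text \<open>What the growth comparisons retain of the Poincare condition: a single ray and, for each
  entry, some expansion whose leading term is that of the identity matrix.\<close>

definition canonical_on ::
  "nat \<Rightarrow> nat \<Rightarrow> complex \<Rightarrow> (nat \<Rightarrow> complex) \<Rightarrow> (complex \<Rightarrow> pmat) \<Rightarrow> real \<Rightarrow> bool" where
  "canonical_on m n h u F \<theta> \<longleftrightarrow> (\<forall>x\<in>idx m n. \<forall>y\<in>idx m n. \<exists>c. c 0 = (if x = y then 1 else 0) \<and>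
     ray_expansion (\<lambda>w. normalized m h u F w x y) c \<theta>)"

lemma fundamental_solution_tw:
  assumes "fundamental_solution m n h u F"
  shows "swap_fundamental m n h u (\<lambda>w. tw m (F w))"
  unfolding swap_fundamental_def
proof (intro conjI allI ballI)
  fix y assume y: "y \<in> idx m n"
  show "swap_solution m n h u (\<lambda>w x. tw m (F w) x y)"
    unfolding swap_solution_def
  proof (intro allI ballI)
    fix w x assume x: "x \<in> idx m n"
    let ?A = "tscale h (Umat m n u + tscale (1 / exp w) (Pmat m n))"
    have A: "tw m ?A x z = h * (tw m (Umat m n u) x z + 1 / exp w * tw m (Pmat m n) x z)" for z
      by (simp add: tw_def tscale_def algebra_simps)
    have "((\<lambda>w. tw m (F w) x y) has_field_derivative exp w * tw m (tmult m n ?A (F w)) x y) (at w)"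
      using assms DERIV_cmult[of "\<lambda>w. F w (fst x) (fst y) (snd x) (snd y)"]
      unfolding fundamental_solution_def tw_def
      by (simp only: mult.left_commute[of "exp w"])
    also have "exp w * tw m (tmult m n ?A (F w)) x y =
       exp w * h * u (snd x) * tw m (F w) x y - h * eps m x * tw m (F w) (prod.swap x) y"
    proof -
      \<comment> \<open>The contributions of \<open>U\<close> and \<open>P\<close> stay separate
        summands, so that the formula also covers \<open>x = prod.swap x\<close>, where both fall on
        the same index.\<close>
      have "tw m (tmult m n ?A (F w)) x y =
        (\<Sum>z\<in>idx m n. (if z = x then h * u (snd x) * tw m (F w) x y else 0)
           + (if z = prod.swap x then - (h / exp w * eps m x * tw m (F w) (prod.swap x) y) else 0))"
        unfolding tw_tmult A
        by (intro sum.cong refl) (auto simp: Umat_eq_diagT tw_diagT tw_Pmat x algebra_simps)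
      also have "\<dots> = h * u (snd x) * tw m (F w) x y - h / exp w * eps m x * tw m (F w) (prod.swap x) y"
        using x by (simp add: sum.distrib sum.delta)
      finally show ?thesis by (simp only:) (simp add: right_diff_distrib)
    qed
    finally show "((\<lambda>w. tw m (F w) x y) has_field_derivative
       exp w * h * u (snd x) * tw m (F w) x y - h * eps m x * tw m (F w) (prod.swap x) y) (at w)" .
  qed
next
  fix w
  obtain G where G: "tmult m n (F w) G = tone m n" "tmult m n G (F w) = tone m n"
    using assms unfolding fundamental_solution_def tinverse_def by blast
  show "\<exists>G. \<forall>x\<in>idx m n. \<forall>y\<in>idx m n.
        (\<Sum>z\<in>idx m n. tw m (F w) x z * G z y) = (if x = y then 1 else 0) \<and>
        (\<Sum>z\<in>idx m n. G x z * tw m (F w) z y) = (if x = y then 1 else 0)"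
    by (rule exI[of _ "tw m G"]) (simp add: tw_tmult[symmetric] G tw_tone)
qed

text \<open>Anti-Stokes directions on either side of \<open>d\<close> differ strictly from it, so
  the closed interval of radius \<open>pi / 2\<close> about \<open>d\<close> lies in the sector. The
  uniform expansion is used on the one-point interval \<open>{\<theta>..\<theta>}\<close>, and the
  twist only changes signs.\<close>

lemma canonical_solution_tw:
  assumes F: "canonical_solution m n h u H d F" and H: "formal_solution m n h u H"
    and \<theta>: "d - pi / 2 \<le> \<theta>" "\<theta> \<le> d + pi / 2"
  shows "canonical_on m n h u (\<lambda>w. tw m (F w)) \<theta>"
  unfolding canonical_on_def
proof (intro ballI)
  fix x y assume xy: "x \<in> idx m n" "y \<in> idx m n"
  define i j k l where "i = fst x" and "j = fst y" and "k = snd x" and "l = snd y"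
  define s :: complex where "s = (-1) ^ ((par m k + par m l) * par m j)"
  have s: "cmod s = 1" unfolding s_def by (simp add: norm_power)
  define X where "X = (\<lambda>w. tmult m n (tmult m n (F w) (texp m n (tscale (- h * w) (deltaP m n))))
              (texp m n (tscale (- h * exp w) (Umat m n u))))"
  have X: "s * X w i j k l = normalized m h u (\<lambda>w. tw m (F w)) w x y" for w
    using xy unfolding X_def normalized_def tw_def dlt_def deltaP_eq_diagT Umat_eq_diagT tscale_diagT texp_diagT
      tmult_diagT_right s_def i_def j_def k_def l_def
    by (auto simp: idx_def)
  have "\<theta> \<in> Stokes_sector m n h u d"
    using \<theta> unfolding Stokes_sector_def by auto
  then have "{\<theta>..\<theta>} \<subseteq> Stokes_sector m n h u d" by simp
  then have "\<forall>N i j k l. \<exists>C \<rho>. \<forall>w. Im w \<in> {\<theta>..\<theta>} \<and> cmod (exp w) \<ge> \<rho> \<longrightarrow>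
        cmod (X w i j k l - (\<Sum>t<N. H t i j k l / exp w ^ t)) \<le> C / cmod (exp w) ^ N"
    using F unfolding canonical_solution_def poincare_asymp_def X_def by blast
  then have asy: "\<exists>C \<rho>. \<forall>w. Im w = \<theta> \<and> cmod (exp w) \<ge> \<rho> \<longrightarrow>
        cmod (X w i j k l - (\<Sum>t<N. H t i j k l / exp w ^ t)) \<le> C / cmod (exp w) ^ N" for N
    by (simp only: atLeastAtMost_singleton singleton_iff)
  have "ray_expansion (\<lambda>w. normalized m h u (\<lambda>w. tw m (F w)) w x y) (\<lambda>t. s * H t i j k l) \<theta>"
    unfolding ray_expansion_def
  proof
    fix N
    have "cmod (normalized m h u (\<lambda>w. tw m (F w)) w x y - (\<Sum>t<N. s * H t i j k l / exp w ^ t))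
      = cmod (X w i j k l - (\<Sum>t<N. H t i j k l / exp w ^ t))" for w
    proof -
      have "normalized m h u (\<lambda>w. tw m (F w)) w x y - (\<Sum>t<N. s * H t i j k l / exp w ^ t)
        = s * (X w i j k l - (\<Sum>t<N. H t i j k l / exp w ^ t))"
        unfolding X[symmetric] by (simp add: right_diff_distrib sum_distrib_left)
      then show ?thesis using s by (simp add: norm_mult)
    qed
    with asy[of N] show "\<exists>C \<rho>. \<forall>w. Im w = \<theta> \<and> cmod (exp w) \<ge> \<rho> \<longrightarrow>
        cmod (normalized m h u (\<lambda>w. tw m (F w)) w x y - (\<Sum>t<N. s * H t i j k l / exp w ^ t)) \<le> C / cmod (exp w) ^ N"
      by simp
  qed
  moreover have "s * H 0 i j k l = (if x = y then 1 else 0)"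
  proof -
    have "s * H 0 i j k l = tw m (H 0) x y"
      by (simp add: tw_def s_def i_def j_def k_def l_def)
    also have "\<dots> = tw m (tone m n) x y" using H by (simp add: formal_solution_def)
    finally show ?thesis using xy by (simp add: tw_tone)
  qed
  ultimately show "\<exists>c. c 0 = (if x = y then 1 else 0) \<and>
     ray_expansion (\<lambda>w. normalized m h u (\<lambda>w. tw m (F w)) w x y) c \<theta>"
    by (intro exI[of _ "\<lambda>t. s * H t i j k l"]) simp
qed

text \<open>The combination of columns with the same value as \<open>f\<close> at
  \<open>w = 0\<close>, that is at \<open>z = 1\<close>, agrees with \<open>f\<close> everywhere by
  uniqueness.\<close>

lemma swap_solution_combination:
  assumes F: "swap_fundamental m n h u F" and f: "swap_solution m n h u f"
  obtains v where "\<And>w x. x \<in> idx m n \<Longrightarrow> f w x = (\<Sum>z\<in>idx m n. F w x z * v z)"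
proof -
  obtain G where G: "\<And>x y. x \<in> idx m n \<Longrightarrow> y \<in> idx m n \<Longrightarrow>
      (\<Sum>z\<in>idx m n. F 0 x z * G z y) = (if x = y then 1 else 0)"
    using F[unfolded swap_fundamental_def, THEN conjunct2, THEN spec, of 0] by (elim exE) blast
  \<comment> \<open>The initial vector in the basis of columns: \<open>G\<close> is the inverse of
    \<open>F 0\<close>.\<close>
  define v where "v = (\<lambda>z. \<Sum>y\<in>idx m n. G z y * f 0 y)"
  define g where "g = (\<lambda>w x. f w x - (\<Sum>z\<in>idx m n. F w x z * v z))"
  have "g w x = 0" if "x \<in> idx m n" for w x
  proof (rule linear_ode_zero[where f = g and K = "idx m n" and M = "\<lambda>w x y. (if y = x then exp w * h * u (snd x) else 0)
      + (if y = prod.swap x then - (h * eps m x) else 0)"])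
    fix w x assume x: "x \<in> idx m n"
    have "((\<lambda>w. g w x) has_field_derivative
        (exp w * h * u (snd x) * f w x - h * eps m x * f w (prod.swap x))
        - (\<Sum>z\<in>idx m n. (exp w * h * u (snd x) * F w x z - h * eps m x * F w (prod.swap x) z) * v z)) (at w)"
      unfolding g_def
      using F f x unfolding swap_fundamental_def swap_solution_def
      by (intro DERIV_diff DERIV_sum DERIV_cmult_right) auto
    moreover have "(exp w * h * u (snd x) * f w x - h * eps m x * f w (prod.swap x))
        - (\<Sum>z\<in>idx m n. (exp w * h * u (snd x) * F w x z - h * eps m x * F w (prod.swap x) z) * v z)
      = exp w * h * u (snd x) * g w x - h * eps m x * g w (prod.swap x)"
      unfolding g_def by (simp add: algebra_simps sum_subtractf sum_distrib_left)
    moreover have "\<dots> = (\<Sum>y\<in>idx m n. (if y = x then exp w * h * u (snd x) * g w x else 0)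
      + (if y = prod.swap x then - (h * eps m x * g w (prod.swap x)) else 0))"
      using x by (simp add: sum.distrib)
    moreover have "\<dots> = (\<Sum>y\<in>idx m n. ((if y = x then exp w * h * u (snd x) else 0)
      + (if y = prod.swap x then - (h * eps m x) else 0)) * g w y)"
      by (intro sum.cong refl) (auto simp: algebra_simps)
    ultimately show "((\<lambda>w. g w x) has_field_derivative (\<Sum>y\<in>idx m n. ((if y = x then exp w * h * u (snd x) else 0)
      + (if y = prod.swap x then - (h * eps m x) else 0)) * g w y)) (at w)"
      by (simp only:)
  next
    fix x y
    show "continuous_on UNIV (\<lambda>w. (if y = x then exp w * h * u (snd x) else 0)
        + (if y = prod.swap x then - (h * eps m x) else 0))"
      by (cases "y = x"; cases "y = prod.swap x") (auto intro!: continuous_intros)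
  next
    fix x assume x: "x \<in> idx m n"
    have "(\<Sum>z\<in>idx m n. F 0 x z * v z) = (\<Sum>y\<in>idx m n. (\<Sum>z\<in>idx m n. F 0 x z * G z y) * f 0 y)"
      unfolding v_def sum_distrib_left sum_distrib_right by (subst sum.swap) (simp add: mult_ac)
    also have "\<dots> = (\<Sum>y\<in>idx m n. if x = y then f 0 y else 0)"
      by (intro sum.cong refl) (simp add: G x)
    finally show "g 0 x = 0" unfolding g_def using x by simp
  qed (use that in auto)
  then show ?thesis using that[of v] unfolding g_def by simp
qed

text \<open>Linear independence of the columns at one point, read off from the left inverse
  there.\<close>

lemma swap_fundamental_cancel:
  assumes G: "swap_fundamental m n h u G"
    and T: "\<And>x. x \<in> idx m n \<Longrightarrow> (\<Sum>z\<in>idx m n. G w x z * T z) = 0"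
    and t: "t \<in> idx m n"
  shows "T t = 0"
proof -
  obtain H where H: "\<And>x y. x \<in> idx m n \<Longrightarrow> y \<in> idx m n \<Longrightarrow>
      (\<Sum>z\<in>idx m n. H x z * G w z y) = (if x = y then 1 else 0)"
    using G[unfolded swap_fundamental_def, THEN conjunct2, THEN spec, of w] by (elim exE) blast
  have "0 = (\<Sum>x\<in>idx m n. H t x * (\<Sum>z\<in>idx m n. G w x z * T z))"
    by (simp add: T)
  also have "\<dots> = (\<Sum>z\<in>idx m n. (\<Sum>x\<in>idx m n. H t x * G w x z) * T z)"
    unfolding sum_distrib_left sum_distrib_right by (subst sum.swap) (simp only: mult.assoc)
  also have "\<dots> = (\<Sum>z\<in>idx m n. if t = z then T z else 0)"
    by (intro sum.cong refl) (simp add: H t)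
  finally show ?thesis using t by simp
qed

section \<open>Connection coefficients and their growth\<close>

definition ratio :: "nat \<Rightarrow> complex \<Rightarrow> (nat \<Rightarrow> complex) \<Rightarrow> complex \<Rightarrow> pmat" where
  "ratio m h u w z y = exp (h * (u (snd z) - u (snd y)) * exp w + h * (dlt m z - dlt m y) * w)"

text \<open>Normalizing \<open>F v\<close> at column \<open>y\<close> conjugates the constants
  \<open>v\<close> by \<open>e^(hUz) z^(h deltaP)\<close>; \<open>ratio\<close> is the quotient of
  the diagonal entries of this factor at \<open>z\<close> and \<open>y\<close>.\<close>

lemma normalized_sum:
  assumes "A w x y = (\<Sum>z\<in>K. F w x z * v z)"
  shows "normalized m h u A w x y = (\<Sum>z\<in>K. normalized m h u F w x z * (ratio m h u w z y * v z))"
proof -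
  have "exp (- h * w * dlt m y) * exp (- h * exp w * u (snd y))
    = exp (- h * w * dlt m z) * exp (- h * exp w * u (snd z)) * ratio m h u w z y" for z
    unfolding ratio_def exp_add[symmetric] by (rule arg_cong[of _ _ exp]) (simp add: algebra_simps)
  then have eq: "F w x z * v z * (exp (- h * w * dlt m y) * exp (- h * exp w * u (snd y)))
     = normalized m h u F w x z * (ratio m h u w z y * v z)" for z
    unfolding normalized_def by (simp add: mult_ac)
  have "normalized m h u A w x y =
      (\<Sum>z\<in>K. F w x z * v z) * (exp (- h * w * dlt m y) * exp (- h * exp w * u (snd y)))"
    unfolding normalized_def assms by (simp only: mult.assoc)
  also have "\<dots> = (\<Sum>z\<in>K. normalized m h u F w x z * (ratio m h u w z y * v z))"
    by (simp only: sum_distrib_right eq)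
  finally show ?thesis .
qed

lemma canonical_on_tendsto:
  assumes "canonical_on m n h u F \<phi>" "x \<in> idx m n" "y \<in> idx m n"
  shows "((\<lambda>r. normalized m h u F (Complex r \<phi>) x y) \<longlongrightarrow> (if x = y then 1 else 0)) at_top"
proof -
  obtain c where c: "c 0 = (if x = y then 1 else 0)"
    and "ray_expansion (\<lambda>w. normalized m h u F w x y) c \<phi>"
    using assms unfolding canonical_on_def by blast
  then show ?thesis
    using ray_expansion_tendsto by (simp only: c[symmetric])
qed

text \<open>The normalized \<open>F\<close> tends to the identity along the ray, so the limit of its
  product with the conjugated coefficients is the limit of these coefficients themselves.\<close>

lemma ratio_tendsto:
  assumes F: "canonical_on m n h u F \<phi>"
    and A: "\<And>w x. x \<in> idx m n \<Longrightarrow> A w x y = (\<Sum>z\<in>idx m n. F w x z * v z)"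
    and lim: "\<And>x. x \<in> idx m n \<Longrightarrow> ((\<lambda>r. normalized m h u A (Complex r \<phi>) x y) \<longlongrightarrow> b x) at_top"
    and z: "z \<in> idx m n"
  shows "((\<lambda>r. ratio m h u (Complex r \<phi>) z y * v z) \<longlongrightarrow> b z) at_top"
proof (rule tendsto_of_tendsto_near_identity[where K = "idx m n" and X = "\<lambda>r. normalized m h u F (Complex r \<phi>)"
      and a = "\<lambda>r z. ratio m h u (Complex r \<phi>) z y * v z"])
  fix x assume x: "x \<in> idx m n"
  show "((\<lambda>r. \<Sum>z\<in>idx m n. normalized m h u F (Complex r \<phi>) x z * (ratio m h u (Complex r \<phi>) z y * v z)) \<longlongrightarrow> b x) at_top"
    using lim[OF x] by (simp only: normalized_sum[where A = A and F = F and K = "idx m n" and v = v, OF A[OF x]])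
qed (use canonical_on_tendsto[OF F] z in auto)

text \<open>In the application \<open>\<theta>\<close> is \<open>d + pi / 2\<close>, a ray lying in
  the sectors of both \<open>d\<close> and \<open>d + pi\<close>. Decay orders the exponentials
  along it by index, and in reverse order on the opposite rays.\<close>

locale stokes_ray =
  fixes m n :: nat and h :: complex and u :: "nat \<Rightarrow> complex" and \<theta> :: real
  assumes irrational: "h \<notin> \<rat>"
    and decay: "\<And>i j. i \<in> {1..m+n} \<Longrightarrow> j \<in> {1..m+n} \<Longrightarrow> i < j \<Longrightarrow> Re (h * (u i - u j) * cis \<theta>) < 0"
begin

lemma ratio_bounded_imp_zero:
  assumes z: "z \<in> idx m n" and y: "y \<in> idx m n" and "snd y < snd z"
    and lim: "((\<lambda>r. ratio m h u (Complex r \<theta>) z y * v) \<longlongrightarrow> l) at_top"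
  shows "v = 0"
proof (rule exp_exp_ray_tendsto_imp_zero)
  have "Re (h * (u (snd y) - u (snd z)) * cis \<theta>) < 0"
    using assms by (intro decay) (auto simp: idx_def)
  then show "0 < Re (h * (u (snd z) - u (snd y)) * cis \<theta>)"
    by (simp add: algebra_simps)
qed (use lim in \<open>simp add: ratio_def\<close>)

lemma ratio_bounded_imp_zero_opposite:
  assumes z: "z \<in> idx m n" and y: "y \<in> idx m n" and "snd z < snd y"
    and \<theta>': "cis \<theta>' = - cis \<theta>"
    and lim: "((\<lambda>r. ratio m h u (Complex r \<theta>') z y * v) \<longlongrightarrow> l) at_top"
  shows "v = 0"
proof (rule exp_exp_ray_tendsto_imp_zero)
  have "Re (h * (u (snd z) - u (snd y)) * cis \<theta>) < 0"
    using assms by (intro decay) (auto simp: idx_def)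
  then show "0 < Re (h * (u (snd z) - u (snd y)) * cis \<theta>')"
    unfolding \<theta>' by simp
qed (use lim in \<open>simp add: ratio_def\<close>)

text \<open>Left multiplication by the block scalar \<open>c\<close> preserves solutions, so column
  \<open>y\<close> of \<open>c F\<close> is \<open>F v\<close> with \<open>v\<close> constant.
  Asymptotics force \<open>v\<close> to be \<open>c y\<close> times the unit vector at
  \<open>y\<close>. For indicators of blocks this says that \<open>F\<close> is block
  diagonal.\<close>

lemma canonical_commutes:
  assumes F: "swap_fundamental m n h u F"
    and \<theta>': "cis \<theta>' = - cis \<theta>"
    and can1: "canonical_on m n h u F \<theta>'" and can2: "canonical_on m n h u F \<theta>"
    and c: "\<And>x. c (prod.swap x) = c x"
    and x: "x \<in> idx m n" and y: "y \<in> idx m n"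
  shows "c x * F w x y = c y * F w x y"
proof -
  have "swap_solution m n h u (\<lambda>w x. c x * F w x y)"
    unfolding swap_solution_def
  proof (intro allI ballI)
    fix w x assume x: "x \<in> idx m n"
    have "((\<lambda>w. c x * F w x y) has_field_derivative
       c x * (exp w * h * u (snd x) * F w x y - h * eps m x * F w (prod.swap x) y)) (at w)"
      using F x y unfolding swap_fundamental_def swap_solution_def by (intro DERIV_cmult) auto
    then show "((\<lambda>w. c x * F w x y) has_field_derivative
       exp w * h * u (snd x) * (c x * F w x y) - h * eps m x * (c (prod.swap x) * F w (prod.swap x) y)) (at w)"
      by (simp add: c algebra_simps)
  qed
  from swap_solution_combination[OF F this] obtain v where
    v: "\<And>w x. x \<in> idx m n \<Longrightarrow> c x * F w x y = (\<Sum>z\<in>idx m n. F w x z * v z)" by blast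
  define A where "A = (\<lambda>w x y. c x * F w x y)"
  have A: "\<And>w x. x \<in> idx m n \<Longrightarrow> A w x y = (\<Sum>z\<in>idx m n. F w x z * v z)"
    using v by (simp add: A_def)
  have nA: "normalized m h u A w x y = c x * normalized m h u F w x y" for w x
    by (simp add: normalized_def A_def)
  have lim: "((\<lambda>r. ratio m h u (Complex r \<phi>) z y * v z) \<longlongrightarrow> c z * (if z = y then 1 else 0)) at_top"
    if "z \<in> idx m n" "canonical_on m n h u F \<phi>" for z \<phi>
    by (rule ratio_tendsto[where A = A and b = "\<lambda>z. c z * (if z = y then 1 else 0)", OF that(2) A _ that(1)])
       (auto simp only: nA intro!: tendsto_mult tendsto_const canonical_on_tendsto[OF that(2) _ y])
  \<comment> \<open>For distinct second components the exponential factor blows up on one of the two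
    opposite rays.\<close>
  have v1: "v z = 0" if "z \<in> idx m n" "snd z \<noteq> snd y" for z
    using that ratio_bounded_imp_zero[OF that(1) y _ lim[OF that(1) can2]]
      ratio_bounded_imp_zero_opposite[OF that(1) y _ \<theta>' lim[OF that(1) can1]]
    by linarith
  have v2: "v z = c z * (if z = y then 1 else 0)" if "z \<in> idx m n" "snd z = snd y" "dlt m z = dlt m y" for z
    using lim[OF that(1) can2] that by (simp add: ratio_def tendsto_const_iff)
  \<comment> \<open>Growth alone does not exclude these entries: they contribute \<open>z\<^sup>\<plusminus>\<^sup>h\<close>, which may decay.\<close>
  have v3: "v x = 0" if x: "x \<in> idx m n" "snd x = snd y" "dlt m x \<noteq> dlt m y" for x
  proof -
    define \<mu> where "\<mu> = h * (dlt m x - dlt m y)"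
    \<comment> \<open>Two distinct pairs with the same second component are not both diagonal, and
      different values of \<open>dlt\<close> mean that exactly one is.\<close>
    have "\<mu> = h \<or> \<mu> = - h"
      using x unfolding \<mu>_def dlt_def by (auto simp: par_def)
    then have \<mu>: "\<mu> \<notin> \<int>"
      using irrational Ints_subset_Rats by (metis Rats_minus_iff subsetD)
    \<comment> \<open>The entries that can still be nonzero have the second component of
      \<open>y\<close> and a value of \<open>dlt\<close> other than that of \<open>y\<close>. This
      leaves one possible value, so they all carry the same power \<open>z^\<mu>\<close>.\<close>
    have rz: "ratio m h u w z y * v z = exp (\<mu> * w) * v z" if "z \<in> idx m n - {y}" for w z
    proof (cases "v z = 0")
      case False
      then have "snd z = snd y" using v1[of z] that by blast
      moreover have "dlt m z \<noteq> dlt m y" using v2[of z] that calculation False by auto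
      moreover have "dlt m z = dlt m x"
        using x calculation unfolding dlt_def by (auto split: if_splits)
      ultimately show ?thesis by (simp add: ratio_def \<mu>_def)
    qed simp
    have vy: "v y = c y" using v2[OF y] by simp
    \<comment> \<open>The term at \<open>y\<close> is moved to the left. There an entry with an
      expansion in \<open>1/z\<close> is multiplied by \<open>z^(-\<mu>)\<close>, while the right
      side tends to \<open>v x\<close>.\<close>
    have eq: "(c x - c y) * normalized m h u F w x y * exp (- \<mu> * w) = (\<Sum>z\<in>idx m n - {y}. normalized m h u F w x z * v z)" for w
    proof -
      have "c x * normalized m h u F w x y = normalized m h u F w x y * (ratio m h u w y y * v y)
          + (\<Sum>z\<in>idx m n - {y}. normalized m h u F w x z * (ratio m h u w z y * v z))"
        unfolding nA[symmetric] normalized_sum[where A = A and F = F and K = "idx m n" and v = v, OF A[OF x(1)]]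
        using y by (simp add: sum.remove)
      also have "ratio m h u w y y = 1" by (simp add: ratio_def)
      also have "(\<Sum>z\<in>idx m n - {y}. normalized m h u F w x z * (ratio m h u w z y * v z))
         = exp (\<mu> * w) * (\<Sum>z\<in>idx m n - {y}. normalized m h u F w x z * v z)"
        unfolding sum_distrib_left by (intro sum.cong refl) (simp only: rz, simp only: mult_ac)
      finally have "(c x - c y) * normalized m h u F w x y = exp (\<mu> * w) * (\<Sum>z\<in>idx m n - {y}. normalized m h u F w x z * v z)"
        by (simp add: vy algebra_simps)
      then show ?thesis by (simp add: exp_minus field_simps)
    qed
    obtain e where "ray_expansion (\<lambda>w. normalized m h u F w x y) e \<theta>"
      using can2 x y unfolding canonical_on_def by blast
    then show ?thesis
    proof (rule ray_expansion_noninteger_power[OF _ _ \<mu>])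
      have "((\<lambda>r. \<Sum>z\<in>idx m n - {y}. normalized m h u F (Complex r \<theta>) x z * v z) \<longlongrightarrow>
          (\<Sum>z\<in>idx m n - {y}. (if x = z then 1 else 0) * v z)) at_top"
        by (intro tendsto_sum tendsto_mult tendsto_const canonical_on_tendsto[OF can2 x(1)]) auto
      also have "(\<Sum>z\<in>idx m n - {y}. (if x = z then 1 else 0) * v z) = (\<Sum>z\<in>idx m n - {y}. if z = x then v z else 0)"
        by (intro sum.cong refl) auto
      also have "\<dots> = v x" using x by (auto simp: sum.delta)
      finally show "((\<lambda>r. (c x - c y) * normalized m h u F (Complex r \<theta>) x y * exp (- \<mu> * Complex r \<theta>)) \<longlongrightarrow> v x) at_top"
        unfolding eq .
    qed
  qed
  have "v z = (if z = y then c y else 0)" if "z \<in> idx m n" for z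
    using v1[OF that] v2[OF that] v3[OF that] by (cases "snd z = snd y"; cases "dlt m z = dlt m y") auto
  then have "(\<Sum>z\<in>idx m n. F w x z * v z) = (\<Sum>z\<in>idx m n. if z = y then F w x z * c y else 0)"
    by (intro sum.cong refl) auto
  then show ?thesis using v[OF x] y by simp
qed

text \<open>Non-resonance: the denominators of the Frobenius recursion do not vanish for
  \<open>g = h eps\<close>.\<close>

lemma two_g_not_nat: "of_nat k \<noteq> 2 * (h * eps m x)" for k :: nat
proof
  assume k: "of_nat k = 2 * (h * eps m x)"
  have "eps m x = 1 \<or> eps m x = - 1" by (auto simp: eps_def minus_one_power_iff)
  then have "h = of_nat k / 2 \<or> h = - (of_nat k / 2)" using k by auto
  then have "h \<in> \<rat>"
    by (metis Rats_divide Rats_minus_iff Rats_of_nat Rats_number_of)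
  then show False using irrational by simp
qed

text \<open>Reading off a leading coefficient: on a ray where the exponential of the swapped index
  is subdominant, removing the exponential of \<open>x\<close> from component \<open>x\<close>
  leaves the coefficient of column \<open>x\<close>. No power of \<open>z\<close> appears, since
  \<open>dlt\<close> is 0 on the block.\<close>

lemma block_limit:
  assumes F: "canonical_on m n h u F \<phi>" and x: "x \<in> idx m n" "fst x \<noteq> snd x"
    and f: "\<And>w. f w = F w x x * a + F w x (prod.swap x) * b"
    and dec: "Re (h * (u (fst x) - u (snd x)) * cis \<phi>) < 0"
  shows "((\<lambda>r. f (Complex r \<phi>) * exp (- h * exp (Complex r \<phi>) * u (snd x))) \<longlongrightarrow> a) at_top"
proof -
  have d: "dlt m x = 0" "dlt m (prod.swap x) = 0" using x by (auto simp: dlt_def)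
  have "f w * exp (- h * exp w * u (snd x)) = normalized m h u F w x x * a
      + normalized m h u F w x (prod.swap x) * (ratio m h u w (prod.swap x) x * b)" for w
  proof -
    have "exp (- h * exp w * u (snd x)) = exp (- h * exp w * u (fst x)) * ratio m h u w (prod.swap x) x"
      unfolding ratio_def exp_add[symmetric] by (rule arg_cong[of _ _ exp]) (simp add: d algebra_simps)
    then show ?thesis
      unfolding f normalized_def by (simp add: d algebra_simps)
  qed
  moreover have "((\<lambda>r. normalized m h u F (Complex r \<phi>) x x * a + normalized m h u F (Complex r \<phi>) x (prod.swap x)
      * (ratio m h u (Complex r \<phi>) (prod.swap x) x * b)) \<longlongrightarrow> 1 * a + 0 * (0 * b)) at_top"
  proof (intro tendsto_add tendsto_mult tendsto_const)
    show "((\<lambda>r. normalized m h u F (Complex r \<phi>) x x) \<longlongrightarrow> 1) at_top"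
      using canonical_on_tendsto[OF F x(1) x(1)] by simp
    have "x \<noteq> prod.swap x" using x by (cases x) auto
    then show "((\<lambda>r. normalized m h u F (Complex r \<phi>) x (prod.swap x)) \<longlongrightarrow> 0) at_top"
      using canonical_on_tendsto[OF F x(1), of "prod.swap x"] x(1) by simp
    show "((\<lambda>r. ratio m h u (Complex r \<phi>) (prod.swap x) x) \<longlongrightarrow> 0) at_top"
      unfolding ratio_def using dec by (intro exp_exp_ray_tendsto_zero) simp
  qed
  ultimately show ?thesis by simp
qed

end

subsection \<open>The half-turn eigenvector\<close>

text \<open>
  For \<open>p = \<Sum> frob c g n z\<^sup>n\<close>, the vector \<open>z\<^sup>-\<^sup>g (p(z), p(-z))\<close> solves
  \<open>x' = -c x - g y/z\<close>, \<open>y' = c y - g x/z\<close>.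
\<close>

primrec frob :: "complex \<Rightarrow> complex \<Rightarrow> nat \<Rightarrow> complex" where
  "frob c g 0 = 1"
| "frob c g (Suc n) = - c * frob c g n / (of_nat (Suc n) - (if even n then 2 * g else 0))"

definition frobenius :: "complex \<Rightarrow> complex \<Rightarrow> complex \<Rightarrow> complex" where
  "frobenius c g z = (\<Sum>n. frob c g n * z ^ n)"

lemma summable_frob: "summable (\<lambda>n. frob c g n * z ^ n)"
proof -
  \<comment> \<open>From this index on the denominators exceed \<open>2 |c| |z|\<close> in modulus,
    so consecutive terms shrink at least by half.\<close>
  obtain N where N: "2 * cmod c * cmod z + 2 * cmod g < real N"
    using reals_Archimedean2 by blast
  show ?thesis
  proof (rule summable_ratio_test[of "1/2" N])
    fix n assume n: "N \<le> n"
    define e where "e = of_nat (Suc n) - (if even n then 2 * g else 0)"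
    have "real (Suc n) - 2 * cmod g \<le> cmod e"
      using norm_triangle_ineq2[of "of_nat (Suc n) :: complex" "if even n then 2 * g else 0"]
      unfolding e_def by (auto simp: norm_mult split: if_splits simp del: of_nat_Suc)
    then have e: "2 * cmod c * cmod z < cmod e" using N n by linarith
    then have e0: "0 < cmod e" by (smt (verit) mult_nonneg_nonneg norm_ge_zero)
    have "norm (frob c g (Suc n) * z ^ Suc n) = (cmod c * cmod z / cmod e) * norm (frob c g n * z ^ n)"
      unfolding frob.simps e_def[symmetric] by (simp add: norm_mult norm_divide norm_power)
    also have "\<dots> \<le> 1/2 * norm (frob c g n * z ^ n)"
      using e e0 by (intro mult_right_mono) (auto simp: field_simps)
    finally show "norm (frob c g (Suc n) * z ^ Suc n) \<le> 1/2 * norm (frob c g n * z ^ n)" .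
  qed simp
qed

lemma frobenius_0: "frobenius c g 0 = 1"
  unfolding frobenius_def by (subst suminf_finite[of "{0}"]) auto

text \<open>The recursion is the coefficient form of
  \<open>z p' = - c z p + g (p(z) - p(-z))\<close>: the odd part picks up \<open>2 g\<close> exactly
  at odd degrees.\<close>

lemma frobenius_derivative:
  assumes g: "\<And>n::nat. of_nat n \<noteq> 2 * g"
  obtains D where "(frobenius c g has_field_derivative D) (at z)"
    and "z * D = - c * z * frobenius c g z + g * (frobenius c g z - frobenius c g (- z))"
proof
  define D where "D = (\<Sum>n. diffs (frob c g) n * z ^ n)"
  show "(frobenius c g has_field_derivative D) (at z)"
    unfolding frobenius_def D_def
    by (rule termdiffs_strong_converges_everywhere) (rule summable_frob)
  have S: "(\<lambda>n. frob c g n * z ^ n) sums frobenius c g z" for z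
    unfolding frobenius_def by (rule summable_sums[OF summable_frob])
  have "(\<lambda>n. frob c g n * z ^ n - frob c g n * (- z) ^ n) sums (frobenius c g z - frobenius c g (- z))"
    by (intro sums_diff S)
  \<comment> \<open>The constant terms of \<open>p(z)\<close> and \<open>p(-z)\<close> cancel, so
    the series may start in degree 1.\<close>
  then have "(\<lambda>n. frob c g (Suc n) * z ^ Suc n - frob c g (Suc n) * (- z) ^ Suc n) sums (frobenius c g z - frobenius c g (- z))"
    by (subst sums_Suc_iff) simp
  then have "(\<lambda>n. - c * z * (frob c g n * z ^ n) + g * (frob c g (Suc n) * z ^ Suc n - frob c g (Suc n) * (- z) ^ Suc n))
      sums (- c * z * frobenius c g z + g * (frobenius c g z - frobenius c g (- z)))"
    by (intro sums_add sums_mult S)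
  moreover have "- c * z * (frob c g n * z ^ n) + g * (frob c g (Suc n) * z ^ Suc n - frob c g (Suc n) * (- z) ^ Suc n)
     = z * (diffs (frob c g) n * z ^ n)" for n
  proof -
    have rec: "(of_nat (Suc n) - (if even n then 2 * g else 0)) * frob c g (Suc n) = - c * frob c g n"
    proof -
      have "of_nat (Suc n) - (if even n then 2 * g else 0) \<noteq> 0"
        using g[of "Suc n"] by (auto simp del: of_nat_Suc)
      then show ?thesis by (simp only: frob.simps) (simp del: of_nat_Suc)
    qed
    have "(- z) ^ Suc n = (if even n then - (z ^ Suc n) else z ^ Suc n)"
      by (simp add: power_minus_odd power_minus_even)
    then have "- c * z * (frob c g n * z ^ n) + g * (frob c g (Suc n) * z ^ Suc n - frob c g (Suc n) * (- z) ^ Suc n)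
       = (- c * frob c g n + (if even n then 2 * g else 0) * frob c g (Suc n)) * z ^ Suc n"
      by (simp add: algebra_simps)
    also have "\<dots> = of_nat (Suc n) * frob c g (Suc n) * z ^ Suc n"
      unfolding rec[symmetric] by (simp add: algebra_simps del: frob.simps)
    also have "\<dots> = z * (diffs (frob c g) n * z ^ n)"
      by (simp add: diffs_def del: frob.simps)
    finally show ?thesis .
  qed
  ultimately have "(\<lambda>n. z * (diffs (frob c g) n * z ^ n)) sums (- c * z * frobenius c g z + g * (frobenius c g z - frobenius c g (- z)))"
    by simp
  moreover have "(\<lambda>n. z * (diffs (frob c g) n * z ^ n)) sums (z * D)"
    unfolding D_def
    by (intro sums_mult summable_sums termdiff_converges_all summable_frob)
  ultimately show "z * D = - c * z * frobenius c g z + g * (frobenius c g z - frobenius c g (- z))"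
    using sums_unique2 by blast
qed

text \<open>Continuity and the value 1 at the origin give a nonzero value at some
  \<open>z \<noteq> 0\<close>, which is then written as \<open>exp w\<close>.\<close>

lemma frobenius_nonzero:
  assumes "\<And>n::nat. of_nat n \<noteq> 2 * g"
  obtains w where "frobenius c g (exp w) \<noteq> 0"
proof -
  have "isCont (frobenius c g) 0"
    using frobenius_derivative[OF assms, of c 0] DERIV_isCont by metis
  then have "(frobenius c g \<longlongrightarrow> 1) (at 0)"
    by (simp add: isCont_def frobenius_0)
  then have "\<forall>\<^sub>F z in at 0. frobenius c g z \<noteq> 0 \<and> z \<noteq> 0"
    by (intro eventually_conj tendsto_imp_eventually_ne eventually_neq_at_within) auto
  then obtain z where "frobenius c g z \<noteq> 0" "z \<noteq> 0"
    using eventually_happens trivial_limit_at by fastforce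
  then show ?thesis using that[of "ln z"] by simp
qed

text \<open>The exponential of the mean of the two diagonal entries is split off, which leaves the
  traceless system with diagonal \<open>- c, c\<close>.\<close>

definition half_turn_solution ::
  "nat \<Rightarrow> complex \<Rightarrow> (nat \<Rightarrow> complex) \<Rightarrow> nat \<times> nat \<Rightarrow> complex \<Rightarrow> nat \<times> nat \<Rightarrow> complex" where
  "half_turn_solution m h u y w x =
     (let g = h * eps m y; c = h * (u (fst y) - u (snd y)) / 2;
          s = exp (h * (u (fst y) + u (snd y)) / 2 * exp w - g * w)
      in if x = y then s * frobenius c g (exp w)
         else if x = prod.swap y then s * frobenius c g (- exp w) else 0)"

text \<open>The shift by \<open>\<i> pi\<close> is the half turn \<open>z \<mapsto> -z\<close> on
  the universal cover. It exchanges \<open>p(z)\<close> with \<open>p(-z)\<close>, and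
  \<open>z^(-g)\<close> contributes the eigenvalue \<open>exp (- \<i> pi g)\<close>.\<close>

lemma half_turn_solution_shift:
  fixes m :: nat and h :: complex and u :: "nat \<Rightarrow> complex" and y :: "nat \<times> nat"
  assumes "fst y \<noteq> snd y"
  defines "\<phi> \<equiv> half_turn_solution m h u y"
  shows "\<phi> (w + \<i> * pi) (prod.swap y) * exp (- h * exp (w + \<i> * pi) * u (fst y))
      = exp (- \<i> * pi * (h * eps m y)) * (\<phi> w y * exp (- h * exp w * u (snd y)))"
    and "\<phi> (w + \<i> * pi) y * exp (- h * exp (w + \<i> * pi) * u (snd y))
      = exp (- \<i> * pi * (h * eps m y)) * (\<phi> w (prod.swap y) * exp (- h * exp w * u (fst y)))"
proof -
  have y: "prod.swap y \<noteq> y" using assms by (cases y) auto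
  have e: "exp (w + \<i> * pi) = - exp w" by (simp add: exp_add)
  define g where "g = h * eps m y"
  define \<sigma> where "\<sigma> = h * (u (fst y) + u (snd y)) / 2"
  define c where "c = h * (u (fst y) - u (snd y)) / 2"
  have \<phi>: "\<phi> w y = exp (\<sigma> * exp w - g * w) * frobenius c g (exp w)"
     "\<phi> w (prod.swap y) = exp (\<sigma> * exp w - g * w) * frobenius c g (- exp w)" for w
    using y by (simp_all add: \<phi>_def half_turn_solution_def Let_def g_def \<sigma>_def c_def)
  \<comment> \<open>The two diagonal entries of the block add up to \<open>2 \<sigma>\<close>; hence
    negating \<open>z\<close> exchanges the two exponentials that remain after
    normalization.\<close>
  have \<sigma>: "h * u (fst y) = 2 * \<sigma> - h * u (snd y)" by (simp add: \<sigma>_def algebra_simps add_divide_distrib)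
  have 1: "exp (\<sigma> * - exp w - g * (w + \<i> * pi)) * exp (- h * - exp w * u (fst y))
    = exp (- \<i> * pi * g) * exp (\<sigma> * exp w - g * w) * exp (- h * exp w * u (snd y))"
    unfolding exp_add[symmetric]
    by (rule arg_cong[of _ _ exp]) (use \<sigma> in algebra)
  have 2: "exp (\<sigma> * - exp w - g * (w + \<i> * pi)) * exp (- h * - exp w * u (snd y))
    = exp (- \<i> * pi * g) * exp (\<sigma> * exp w - g * w) * exp (- h * exp w * u (fst y))"
    unfolding exp_add[symmetric]
    by (rule arg_cong[of _ _ exp]) (use \<sigma> in algebra)
  show "\<phi> (w + \<i> * pi) (prod.swap y) * exp (- h * exp (w + \<i> * pi) * u (fst y))
      = exp (- \<i> * pi * (h * eps m y)) * (\<phi> w y * exp (- h * exp w * u (snd y)))"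
    unfolding \<phi> e g_def[symmetric] using arg_cong[OF 1, of "\<lambda>t. t * frobenius c g (exp w)"]
    by (simp only: mult_ac minus_minus)
  show "\<phi> (w + \<i> * pi) y * exp (- h * exp (w + \<i> * pi) * u (snd y))
      = exp (- \<i> * pi * (h * eps m y)) * (\<phi> w (prod.swap y) * exp (- h * exp w * u (fst y)))"
    unfolding \<phi> e g_def[symmetric] using arg_cong[OF 2, of "\<lambda>t. t * frobenius c g (- exp w)"]
    by (simp only: mult_ac minus_minus)
qed

section \<open>From the eigenvector to the Stokes matrix\<close>

context stokes_ray
begin

lemma half_turn_solution_swap_solution:
  assumes "fst y \<noteq> snd y"
  shows "swap_solution m n h u (half_turn_solution m h u y)"
proof -
  define \<phi> where "\<phi> = half_turn_solution m h u y"
  have y: "prod.swap y \<noteq> y" using assms by (cases y) auto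
  define g where "g = h * eps m y"
  define \<sigma> where "\<sigma> = h * (u (fst y) + u (snd y)) / 2"
  define c where "c = h * (u (fst y) - u (snd y)) / 2"
  have \<phi>: "\<phi> w y = exp (\<sigma> * exp w - g * w) * frobenius c g (exp w)"
     "\<phi> w (prod.swap y) = exp (\<sigma> * exp w - g * w) * frobenius c g (- exp w)" for w
    using y by (simp_all add: \<phi>_def half_turn_solution_def Let_def g_def \<sigma>_def c_def)
  have \<phi>0: "\<phi> w x = 0" if "x \<noteq> y" "x \<noteq> prod.swap y" for w x
    using that by (simp add: \<phi>_def half_turn_solution_def)
  have hu: "h * u (fst y) = \<sigma> + c" "h * u (snd y) = \<sigma> - c"
    by (simp_all add: \<sigma>_def c_def field_simps)
  have g: "of_nat k \<noteq> 2 * g" for k :: nat unfolding g_def by (rule two_g_not_nat)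
  show ?thesis
    unfolding swap_solution_def \<phi>_def[symmetric]
  proof (intro allI ballI)
    fix w x
    consider "x = y" | "x = prod.swap y" | "x \<noteq> y" "x \<noteq> prod.swap y" by blast
    then show "((\<lambda>w. \<phi> w x) has_field_derivative
       exp w * h * u (snd x) * \<phi> w x - h * eps m x * \<phi> w (prod.swap x)) (at w)"
    proof cases
      case 1
      obtain D where D: "(frobenius c g has_field_derivative D) (at (exp w))"
        "exp w * D = - c * exp w * frobenius c g (exp w) + g * (frobenius c g (exp w) - frobenius c g (- exp w))"
        using frobenius_derivative[OF g] by metis
      have "((\<lambda>w. frobenius c g (exp w)) has_field_derivative D * exp w) (at w)"
        by (rule DERIV_chain2[OF D(1) DERIV_exp])
      moreover have "((\<lambda>w. exp (\<sigma> * exp w - g * w)) has_field_derivative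
          exp (\<sigma> * exp w - g * w) * (\<sigma> * exp w - g)) (at w)"
        by (auto intro!: derivative_eq_intros)
      ultimately have "((\<lambda>w. \<phi> w y) has_field_derivative
          exp (\<sigma> * exp w - g * w) * (\<sigma> * exp w - g) * frobenius c g (exp w)
          + D * exp w * exp (\<sigma> * exp w - g * w)) (at w)"
        unfolding \<phi> by (rule DERIV_mult[rotated])
      moreover have "exp (\<sigma> * exp w - g * w) * (\<sigma> * exp w - g) * frobenius c g (exp w)
          + D * exp w * exp (\<sigma> * exp w - g * w)
        = exp w * (h * u (snd y)) * \<phi> w y - g * \<phi> w (prod.swap y)"
        unfolding \<phi> hu using D(2) by algebra
      ultimately show ?thesis unfolding 1 g_def by (simp only: mult.assoc)
    next
      case 2
      obtain D where D: "(frobenius c g has_field_derivative D) (at (- exp w))"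
        "- exp w * D = - c * - exp w * frobenius c g (- exp w) + g * (frobenius c g (- exp w) - frobenius c g (- (- exp w)))"
        using frobenius_derivative[OF g] by metis
      have "((\<lambda>w. - exp w) has_field_derivative - exp w) (at w)"
        by (auto intro!: derivative_eq_intros)
      from DERIV_chain2[OF D(1) this]
      have "((\<lambda>w. frobenius c g (- exp w)) has_field_derivative D * - exp w) (at w)" .
      moreover have "((\<lambda>w. exp (\<sigma> * exp w - g * w)) has_field_derivative
          exp (\<sigma> * exp w - g * w) * (\<sigma> * exp w - g)) (at w)"
        by (auto intro!: derivative_eq_intros)
      ultimately have "((\<lambda>w. \<phi> w (prod.swap y)) has_field_derivative
          exp (\<sigma> * exp w - g * w) * (\<sigma> * exp w - g) * frobenius c g (- exp w)
          + D * - exp w * exp (\<sigma> * exp w - g * w)) (at w)"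
        unfolding \<phi> by (rule DERIV_mult[rotated])
      moreover have "exp (\<sigma> * exp w - g * w) * (\<sigma> * exp w - g) * frobenius c g (- exp w)
          + D * - exp w * exp (\<sigma> * exp w - g * w)
        = exp w * (h * u (fst y)) * \<phi> w (prod.swap y) - g * \<phi> w y"
        unfolding \<phi> hu using D(2)[unfolded minus_minus] by algebra
      ultimately show ?thesis unfolding 2 g_def
        by (simp only: mult.assoc eps_swap swap_swap snd_swap)
    next
      case 3
      then have "prod.swap x \<noteq> y" "prod.swap x \<noteq> prod.swap y" by (metis swap_swap)+
      then have "\<phi> w (prod.swap x) = 0" by (intro \<phi>0) auto
      with 3 show ?thesis by (simp add: \<phi>0)
    qed
  qed
qed

text \<open>The common ray \<open>\<theta>\<close> makes \<open>S\<close> unipotent and triangular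
  in each block. The last entry comes from expanding the half-turn eigenvector in the columns of
  \<open>F\<close> and of \<open>G\<close>.\<close>

lemma stokes_matrix_entries:
  assumes F: "swap_fundamental m n h u F"
      "canonical_on m n h u F (\<theta> - pi)" "canonical_on m n h u F \<theta>"
    and G: "swap_fundamental m n h u G"
      "canonical_on m n h u G \<theta>" "canonical_on m n h u G (\<theta> + pi)"
    and S: "\<And>w x y. x \<in> idx m n \<Longrightarrow> y \<in> idx m n \<Longrightarrow> F w x y = (\<Sum>z\<in>idx m n. G w x z * S z y)"
    and x: "x \<in> idx m n" and y: "y \<in> idx m n"
  shows "S x y = (if x = y then 1
     else if x = prod.swap y \<and> fst y < snd y
       then eps m y * (exp (- (pi * \<i> * h)) - exp (pi * \<i> * h)) else 0)"
proof -
  \<comment> \<open>The indicator of the block of \<open>y\<close>, a swap-invariant function to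
    which \<open>canonical_commutes\<close> applies.\<close>
  define sw where "sw = (\<lambda>y x :: nat \<times> nat. if x = y \<or> x = prod.swap y then 1 else 0 :: complex)"
  have sw: "sw y (prod.swap x) = sw y x" for x y
    by (cases x; cases y) (auto simp: sw_def)
  have cis: "cis (\<theta> - pi) = - cis \<theta>" "cis (\<theta> + pi) = - cis \<theta>"
    by (auto simp: complex_eq_iff)
  have F_block: "sw y x * F w x z = sw y z * F w x z" if "x \<in> idx m n" "z \<in> idx m n" for w x y z
    using canonical_commutes[OF F(1) cis(1) F(2,3), of "sw y"] sw that by blast
  have G_block: "sw y x * G w x z = sw y z * G w x z" if "x \<in> idx m n" "z \<in> idx m n" for w x y z
    using canonical_commutes[OF G(1) cis(2) G(3,2), of "sw y"] sw that by blast
  have S0: "S x y = 0" if xy: "x \<in> idx m n" "y \<in> idx m n" and ne: "x \<noteq> y" "x \<noteq> prod.swap y" for x y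
  proof -
    \<comment> \<open>Since \<open>F = G S\<close> and both solutions commute with the indicator,
      \<open>G\<close> annihilates this vector in \<open>x\<close>.\<close>
    have "(sw y x - sw y y) * S x y = 0"
    proof (rule swap_fundamental_cancel[OF G(1) _ xy(1), where w = 0 and T = "\<lambda>x. (sw y x - sw y y) * S x y"])
      fix x assume x: "x \<in> idx m n"
      have "(\<Sum>z\<in>idx m n. G 0 x z * ((sw y z - sw y y) * S z y))
         = (\<Sum>z\<in>idx m n. sw y z * G 0 x z * S z y) - sw y y * F 0 x y"
        unfolding S[OF x xy(2)] sum_distrib_left sum_subtractf[symmetric]
        by (intro sum.cong refl) (simp add: algebra_simps)
      also have "(\<Sum>z\<in>idx m n. sw y z * G 0 x z * S z y) = (\<Sum>z\<in>idx m n. sw y x * G 0 x z * S z y)"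
        by (intro sum.cong refl) (simp only: G_block[OF x])
      also have "\<dots> = sw y x * F 0 x y"
        unfolding S[OF x xy(2)] sum_distrib_left by (simp only: mult.assoc)
      finally show "(\<Sum>z\<in>idx m n. G 0 x z * ((sw y z - sw y y) * S z y)) = 0"
        using F_block[OF x xy(2)] by simp
    qed
    then show ?thesis using ne by (simp add: sw_def)
  qed
  have lim: "((\<lambda>r. ratio m h u (Complex r \<theta>) x y * S x y) \<longlongrightarrow> (if x = y then 1 else 0)) at_top"
    if "x \<in> idx m n" "y \<in> idx m n" for x y
    using that by (intro ratio_tendsto[OF G(2), where A = F and b = "\<lambda>x. if x = y then 1 else 0"] S
        canonical_on_tendsto[OF F(3)]) auto
  have S1: "S x x = 1" if "x \<in> idx m n" for x
    using lim[OF that that] by (simp add: ratio_def tendsto_const_iff)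
  \<comment> \<open>Here the conjugating exponential grows along \<open>\<theta>\<close>, which is
    incompatible with a finite limit unless the entry is 0.\<close>
  have Slow: "S (prod.swap y) y = 0" if "y \<in> idx m n" "snd y < fst y" for y
    using that lim[of "prod.swap y" y] by (intro ratio_bounded_imp_zero[of "prod.swap y" y]) auto
  have Sup: "S (prod.swap y) y = eps m y * (exp (- (pi * \<i> * h)) - exp (pi * \<i> * h))"
    if y: "y \<in> idx m n" and lt: "fst y < snd y" for y
  proof -
    define y' where "y' = prod.swap y"
    have ne: "prod.swap y \<noteq> y" using lt by (cases y) auto
    have y': "y' \<in> idx m n" "y' \<noteq> y" "prod.swap y' = y" "fst y' = snd y" "snd y' = fst y"
      using y ne by (simp_all add: y'_def)
    define \<phi> where "\<phi> = half_turn_solution m h u y"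
    define \<kappa> where "\<kappa> = exp (- \<i> * pi * (h * eps m y))"
    define K where "K = {y, y'}"
    have KI: "K \<subseteq> idx m n" using y y' by (simp add: K_def)
    have "swap_solution m n h u \<phi>"
      unfolding \<phi>_def using lt by (intro half_turn_solution_swap_solution) simp
    from swap_solution_combination[OF F(1) this] obtain v where
      v: "\<And>w x. x \<in> idx m n \<Longrightarrow> \<phi> w x = (\<Sum>z\<in>idx m n. F w x z * v z)" by blast
    have FK: "F w x z = 0" if "x \<in> K" "z \<in> idx m n - K" for w x z
      using F_block[of x z y w] that KI by (auto simp: sw_def K_def y'_def)
    have GK: "G w x z = 0" if "x \<in> K" "z \<in> idx m n - K" for w x z
      using G_block[of x z y w] that KI by (auto simp: sw_def K_def y'_def)
    have \<phi>F: "\<phi> w x = F w x y * v y + F w x y' * v y'" if "x \<in> K" for w x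
    proof -
      have "\<phi> w x = (\<Sum>z\<in>idx m n. F w x z * v z)" using v that KI by blast
      also have "\<dots> = (\<Sum>z\<in>K. F w x z * v z)"
        using KI FK[OF that] by (intro sum.mono_neutral_right) auto
      finally have "\<phi> w x = (\<Sum>z\<in>K. F w x z * v z)" .
      then show ?thesis using y' by (simp add: K_def)
    qed
    have FG: "F w x z = G w x y * S y z + G w x y' * S y' z" if "x \<in> K" "z \<in> K" for w x z
    proof -
      have "F w x z = (\<Sum>t\<in>idx m n. G w x t * S t z)" using S that KI by blast
      also have "\<dots> = (\<Sum>t\<in>K. G w x t * S t z)"
        using KI GK[OF that(1)] by (intro sum.mono_neutral_right) auto
      finally have "F w x z = (\<Sum>t\<in>K. G w x t * S t z)" .
      then show ?thesis using y' by (simp add: K_def)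
    qed
    \<comment> \<open>The coefficient of the eigenvector at column \<open>y'\<close> of
      \<open>G\<close>; its coefficient at \<open>y\<close> stays \<open>v y\<close> because
      \<open>S\<close> is triangular.\<close>
    define b where "b = S y' y * v y + v y'"
    have Syy': "S y y' = 0" using Slow[of y'] y' lt by simp
    have \<phi>G: "\<phi> w x = G w x y * v y + G w x y' * b" if "x \<in> K" for w x
      unfolding \<phi>F[OF that] b_def
      using FG[OF that, of y w] FG[OF that, of y' w] S1[OF y] S1[OF y'(1)] Syy'
      by (simp add: K_def algebra_simps)
    have ji: "snd y \<in> {1..m+n}" "fst y \<in> {1..m+n}" using y by (auto simp: idx_def)
    note dec = decay[OF ji(2,1) lt]
    \<comment> \<open>Leading coefficients on three rays: \<open>v y\<close> from component
      \<open>y\<close> on \<open>\<theta>\<close>, then \<open>v y'\<close> via \<open>F\<close> on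
      \<open>\<theta> - pi\<close> and \<open>b\<close> via \<open>G\<close> on
      \<open>\<theta> + pi\<close>, both from component \<open>y'\<close>. Half turns link
      neighbouring rays.\<close>
    let ?f = "\<lambda>r. \<phi> (Complex r \<theta>) y * exp (- h * exp (Complex r \<theta>) * u (snd y))"
    let ?g = "\<lambda>r. \<phi> (Complex r (\<theta> - pi)) y' * exp (- h * exp (Complex r (\<theta> - pi)) * u (fst y))"
    let ?k = "\<lambda>r. \<phi> (Complex r (\<theta> + pi)) y' * exp (- h * exp (Complex r (\<theta> + pi)) * u (fst y))"
    have f: "(?f \<longlongrightarrow> v y) at_top"
      using y lt dec \<phi>F[of y]
      by (intro block_limit[OF F(3), where x = y and b = "v y'"]) (auto simp: K_def y'_def)
    have g: "(?g \<longlongrightarrow> v y') at_top"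
      unfolding y'(5)[symmetric] using y y' lt dec \<phi>F[of y']
      by (intro block_limit[OF F(2), where x = y' and b = "v y"]) (auto simp: K_def cis algebra_simps)
    have k: "(?k \<longlongrightarrow> b) at_top"
      unfolding y'(5)[symmetric] using y y' lt dec \<phi>G[of y']
      by (intro block_limit[OF G(3), where x = y' and b = "v y"]) (auto simp: K_def cis algebra_simps)
    have shift: "Complex r (t + pi) = Complex r t + \<i> * pi" for r t
      by (simp add: complex_eq_iff)
    have "?k = (\<lambda>r. \<kappa> * ?f r)"
      unfolding shift \<phi>_def \<kappa>_def y'_def using half_turn_solution_shift(1)[of y] lt by auto
    moreover have "((\<lambda>r. \<kappa> * ?f r) \<longlongrightarrow> \<kappa> * v y) at_top" by (intro tendsto_mult tendsto_const f)
    ultimately have "(?k \<longlongrightarrow> \<kappa> * v y) at_top" by (simp only:)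
    then have b1: "b = \<kappa> * v y"
      by (rule tendsto_unique[OF trivial_limit_at_top_linorder k])
    have "?f = (\<lambda>r. \<kappa> * ?g r)"
      using shift[of _ "\<theta> - pi"] half_turn_solution_shift(2)[of y m h u] lt
      unfolding \<phi>_def \<kappa>_def y'_def by simp
    moreover have "((\<lambda>r. \<kappa> * ?g r) \<longlongrightarrow> \<kappa> * v y') at_top" by (intro tendsto_mult tendsto_const g)
    ultimately have "(?f \<longlongrightarrow> \<kappa> * v y') at_top" by (simp only:)
    then have b2: "v y = \<kappa> * v y'"
      by (rule tendsto_unique[OF trivial_limit_at_top_linorder f])
    have \<kappa>0: "\<kappa> \<noteq> 0" by (simp add: \<kappa>_def)
    \<comment> \<open>If \<open>v y\<close> vanished, so would \<open>v y'\<close>, and with them a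
      component that is a nonzero factor times the Frobenius series.\<close>
    have vy: "v y \<noteq> 0"
    proof
      assume "v y = 0"
      then have "\<phi> w y = 0" for w using b2 \<kappa>0 \<phi>F[of y w] by (simp add: K_def)
      moreover obtain w where "frobenius (h * (u (fst y) - u (snd y)) / 2) (h * eps m y) (exp w) \<noteq> 0"
        using frobenius_nonzero[OF two_g_not_nat] by metis
      ultimately show False by (simp add: \<phi>_def half_turn_solution_def Let_def)
    qed
    have "v y' = v y / \<kappa>" using b2 \<kappa>0 by simp
    then have "S y' y * v y = (\<kappa> - 1 / \<kappa>) * v y"
      using b1 by (simp add: b_def left_diff_distrib eq_diff_eq)
    then have "S y' y = \<kappa> - 1 / \<kappa>"
      using vy by simp
    also have "1 / \<kappa> = exp (\<i> * pi * (h * eps m y))"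
      by (simp add: \<kappa>_def exp_minus field_simps)
    \<comment> \<open>The difference is odd in \<open>h eps\<close>, so the sign \<open>eps\<close>
      can be pulled out.\<close>
    also have "\<kappa> - exp (\<i> * pi * (h * eps m y)) = eps m y * (exp (- (pi * \<i> * h)) - exp (pi * \<i> * h))"
    proof -
      have "eps m y = 1 \<or> eps m y = - 1" by (auto simp: eps_def minus_one_power_iff)
      then show ?thesis by (auto simp: \<kappa>_def mult_ac)
    qed
    finally show ?thesis by (simp add: y'_def)
  qed
  show ?thesis
    using S0[OF x y] S1[OF x] Slow[OF y] Sup[OF y]
    by (cases "fst y" "snd y" rule: linorder_cases) (auto, (cases y, simp)+)
qed

end

section \<open>The renormalized Stokes matrix and its inverse\<close>

lemma decay_imp_Re_neg:
  assumes "((\<lambda>r :: real. exp (a * (of_real r * b))) \<longlongrightarrow> 0) at_top"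
  shows "Re (a * b) < 0"
proof (rule ccontr)
  assume *: "\<not> Re (a * b) < 0"
  have "\<forall>\<^sub>F r :: real in at_top. cmod (exp (a * (of_real r * b))) < 1"
    using tendsto_norm_zero[OF assms] by (rule order_tendstoD) simp
  then have "\<forall>\<^sub>F r :: real in at_top. cmod (exp (a * (of_real r * b))) < 1 \<and> r \<ge> 0"
    by (intro eventually_conj eventually_ge_at_top)
  then obtain r :: real where r: "cmod (exp (a * (of_real r * b))) < 1" "r \<ge> 0"
    using eventually_happens trivial_limit_at_top_linorder by blast
  have "a * (of_real r * b) = of_real r * (a * b)" by simp
  then have "Re (a * (of_real r * b)) = r * Re (a * b)" by (simp only:) (simp add: algebra_simps)
  moreover have "Re (a * (of_real r * b)) < 0" using r(1) by (simp only: norm_exp_eq_Re exp_less_one_iff)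
  ultimately show False using r(2) * by (metis mult_nonneg_nonneg not_less)
qed

theorem theorem2p10:
  fixes m n :: nat and h q :: complex and u :: "nat \<Rightarrow> complex" and d :: real and S :: tens
  assumes "h \<notin> \<rat>"
    and "q = exp (pi * \<i> * h)"
    and "inj_on u {1..m+n}"
    and "admissible m n h u d"
    and "\<And>i j. i \<in> {1..m+n} \<Longrightarrow> j \<in> {1..m+n} \<Longrightarrow> i < j \<Longrightarrow>
           ((\<lambda>r :: real. exp (h * (u i - u j) * (of_real r * cis (d + pi / 2)))) \<longlongrightarrow> 0) at_top"
    and "Stokes_plus m n h u d S"
  shows "tinverse m n (renormalized m n h S) (Rmat m n q)"
proof -
  obtain H F F' where S: "S \<in> tens_carrier m n" and H: "formal_solution m n h u H"
    and F: "canonical_solution m n h u H d F" and F': "canonical_solution m n h u H (d + pi) F'"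
    and FS: "\<And>w. F w = tmult m n (F' w) S"
    using assms(6) unfolding Stokes_plus_def by blast
  \<comment> \<open>This ray is the upper end of the interval of radius \<open>pi / 2\<close> about
    \<open>d\<close> and the lower end of the one about \<open>d + pi\<close>.\<close>
  interpret stokes_ray m n h u "d + pi / 2"
    by standard (use assms(1) decay_imp_Re_neg[OF assms(5)] in auto)
  define D where "D = (\<lambda>x. exp (pi * \<i> * h * dlt m x))"
  define A where "A = renormalized m n h S"
  have A_def': "A = tmult m n S (diagT m n (\<lambda>i k. D (i, k)))"
    unfolding A_def renormalized_def deltaP_eq_diagT tscale_diagT texp_diagT D_def dlt_def by (simp cong: if_cong)
  have A: "A \<in> tens_carrier m n"
    unfolding A_def' by (intro tmult_carrier S diagT_carrier)
  have entries: "tw m S x y = (if x = y then 1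
     else if x = prod.swap y \<and> fst y < snd y
       then eps m y * (exp (- (pi * \<i> * h)) - exp (pi * \<i> * h)) else 0)"
    if "x \<in> idx m n" "y \<in> idx m n" for x y
  proof (rule stokes_matrix_entries[OF _ _ _ _ _ _ _ that])
    show "swap_fundamental m n h u (\<lambda>w. tw m (F w))" "swap_fundamental m n h u (\<lambda>w. tw m (F' w))"
      using F F' by (auto simp: canonical_solution_def intro: fundamental_solution_tw)
    show "canonical_on m n h u (\<lambda>w. tw m (F w)) (d + pi / 2 - pi)"
      "canonical_on m n h u (\<lambda>w. tw m (F w)) (d + pi / 2)"
      by (rule canonical_solution_tw[OF F H]; simp)+
    show "canonical_on m n h u (\<lambda>w. tw m (F' w)) (d + pi / 2)"
      "canonical_on m n h u (\<lambda>w. tw m (F' w)) (d + pi / 2 + pi)"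
      by (rule canonical_solution_tw[OF F' H]; simp)+
    show "tw m (F w) x y = (\<Sum>z\<in>idx m n. tw m (F' w) x z * tw m S z y)" for w x y
      by (simp add: FS tw_tmult)
  qed
  have q: "q \<noteq> 0" "exp (pi * \<i> * h) = q" "exp (- (pi * \<i> * h)) = inverse q"
    using assms(2) by (auto simp: exp_minus)
  define k where "k = (\<lambda>x. eps m x * (q - inverse q))"
  define B where "B = (\<lambda>x :: nat \<times> nat. if fst x = snd x then q powi ((-1) ^ par m (fst x)) else 1)"
  \<comment> \<open>On the one-dimensional blocks \<open>(i,i)\<close> the renormalizing factor is
    \<open>q\<close> to the power \<open>- (-1)^|i|\<close>, the reciprocal of the entry of
    \<open>R\<close>.\<close>
  have DB: "D x * B x = 1" "B x * D x = 1" for x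
    using q by (auto simp: D_def B_def dlt_def par_def exp_minus)
  have off: "D x = 1" "B x = 1" if "fst x \<noteq> snd x" for x
    using that by (auto simp: D_def B_def dlt_def)
  have twR: "tw m (Rmat m n q) x y = (if x = y then B x
     else if y = prod.swap x \<and> snd x < fst x then k x else 0)"
    if "x \<in> idx m n" "y \<in> idx m n" for x y
    using tw_Rmat[OF that] by (auto simp: B_def k_def)
  \<comment> \<open>On a two-dimensional block the renormalizing factor is 1, so the renormalized
    matrix and \<open>R\<close> are unipotent triangular with opposite entries \<open>- k\<close>
    and \<open>k\<close>.\<close>
  have twA: "tw m A x y = (if x = y then D x
     else if y = prod.swap x \<and> snd x < fst x then - k x else 0)"
    if xy: "x \<in> idx m n" "y \<in> idx m n" for x y
  proof -
    have "tw m A x y = (\<Sum>z\<in>idx m n. if z = y then tw m S x z * D z else 0)"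
      unfolding A_def' tw_tmult by (intro sum.cong refl) (auto simp: tw_diagT)
    also have "\<dots> = tw m S x y * D y" using xy by simp
    finally show ?thesis
      unfolding entries[OF xy] using xy q off[of y] by (auto simp: k_def algebra_simps)
  qed
  \<comment> \<open>Row \<open>x\<close> of a block diagonal matrix is supported on \<open>x\<close>
    and \<open>prod.swap x\<close>; a diagonal pair must be counted only once.\<close>
  have sum2: "(\<Sum>z\<in>idx m n. f z) = f x + (if prod.swap x = x then 0 else f (prod.swap x))"
    if "x \<in> idx m n" "\<And>z. z \<in> idx m n \<Longrightarrow> z \<noteq> x \<Longrightarrow> z \<noteq> prod.swap x \<Longrightarrow> f z = 0"
    for f :: "nat \<times> nat \<Rightarrow> complex" and x
  proof -
    have "(\<Sum>z\<in>idx m n. f z) = (\<Sum>z\<in>{x, prod.swap x}. f z)"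
      using that by (intro sum.mono_neutral_right) auto
    then show ?thesis by auto
  qed
  have "tmult m n A (Rmat m n q) = tone m n"
  proof (rule tens_eqI)
    fix x y assume xy: "x \<in> idx m n" "y \<in> idx m n"
    have "tw m (tmult m n A (Rmat m n q)) x y = tw m A x x * tw m (Rmat m n q) x y
       + (if prod.swap x = x then 0 else tw m A x (prod.swap x) * tw m (Rmat m n q) (prod.swap x) y)"
      unfolding tw_tmult using xy by (intro sum2) (auto simp: twA)
    also have "\<dots> = (if x = y then 1 else 0)"
    proof (cases "fst x = snd x")
      case True
      then have "prod.swap x = x" by (cases x) auto
      then show ?thesis using xy True DB by (simp add: twA twR)
    next
      case False
      then have "prod.swap x \<noteq> x" by (cases x) auto
      moreover have "fst (prod.swap x) \<noteq> snd (prod.swap x)" using False by auto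
      ultimately show ?thesis using xy False off[of x] off[of "prod.swap x"] by (auto simp: twA twR)
    qed
    finally show "tw m (tmult m n A (Rmat m n q)) x y = tw m (tone m n) x y"
      using xy by (simp add: tw_tone)
  qed (auto intro: tmult_carrier A Rmat_carrier diagT_carrier simp: tone_eq_diagT)
  moreover have "tmult m n (Rmat m n q) A = tone m n"
  proof (rule tens_eqI)
    fix x y assume xy: "x \<in> idx m n" "y \<in> idx m n"
    have "tw m (tmult m n (Rmat m n q) A) x y = tw m (Rmat m n q) x x * tw m A x y
       + (if prod.swap x = x then 0 else tw m (Rmat m n q) x (prod.swap x) * tw m A (prod.swap x) y)"
      unfolding tw_tmult using xy by (intro sum2) (auto simp: twR)
    also have "\<dots> = (if x = y then 1 else 0)"
    proof (cases "fst x = snd x")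
      case True
      then have "prod.swap x = x" by (cases x) auto
      then show ?thesis using xy True DB by (simp add: twA twR)
    next
      case False
      then have "prod.swap x \<noteq> x" by (cases x) auto
      moreover have "fst (prod.swap x) \<noteq> snd (prod.swap x)" using False by auto
      ultimately show ?thesis using xy False off[of x] off[of "prod.swap x"] by (auto simp: twA twR)
    qed
    finally show "tw m (tmult m n (Rmat m n q) A) x y = tw m (tone m n) x y"
      using xy by (simp add: tw_tone)
  qed (auto intro: tmult_carrier A Rmat_carrier diagT_carrier simp: tone_eq_diagT)
  ultimately show ?thesis
    using A Rmat_carrier unfolding tinverse_def A_def by blast
qed

end
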